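(* Let $G=(S,A,\delta,\mathcal{O},\gamma,s_0)$ be a POMDP with a parity objective $\mathsf{Parity}(p)$ with a set $D$ of $d$ priorities. The following assertions hold. (1) If there is a finite-memory positive winning strategy, then there is a positive winning strategy with memory of size at most $2^{3\cdot d\cdot|S|}$. (2) If there is a finite-memory almost-sure winning strategy, then there is an almost-sure winning strategy with memory of size at most $2^{3\cdot d\cdot|S|}$. (3) Finite-memory almost-sure (resp. positive) winning strategies require exponential memory in general, that is, there is a family $(G_n)_{n\ge1}$ of POMDPs of size polynomial in $n$ with parity objectives such that $G_n$ admits a finite-memory almost-sure (resp. positive) winning strategy, but every such strategy uses at least $2^{\Omega(n)}$ memory states. Moreover, belief-based stationary strategies are not sufficient in general: there is a POMDP with a parity objective that has a finite-memory almost-sure (resp. positive) winning strategy but no belief-based stationary almost-sure (resp. positive) winning strategy.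
   Context: For a finite set $X$, $\mathcal{D}(X)$ is the set of probability distributions on $X$ and $\mathrm{Supp}(f)$ the support of $f\in\mathcal{D}(X)$. A POMDP is a tuple $G=(S,A,\delta,\mathcal{O},\gamma,s_0)$ with a finite set $S$ of states, a finite set $A$ of actions, a transition function $\delta:S\times A\to\mathcal{D}(S)$, a finite set $\mathcal{O}$ of observations, an observation function $\gamma:S\to\mathcal{O}$, and an initial state $s_0\in S$. Standing assumption: $\gamma^{-1}(\gamma(s_0))=\{s_0\}$. A finite-memory strategy is $\sigma=(\sigma_u,\sigma_n,M,m_0)$ with $M$ finite, $m_0\in M$, action selection $\sigma_n:M\to\mathcal{D}(A)$ and memory update $\sigma_u:M\times\mathcal{O}\times A\to\mathcal{D}(M)$; its memory size is $|M|$. It induces the finite Markov chain $G\restriction\sigma$ on $S\times M$ with $\delta_\sigma((s',m')\mid(s,m))=\sum_{a\in A}\sigma_n(m)(a)\cdot\delta(s,a)(s')\cdot\sigma_u(m,\gamma(s'),a)(m')$, started at $(s_0,m_0)$; $\mathbb{P}^\sigma$ is the induced probability measure on plays $(s_0,a_0,s_1,a_1,\dots)$. A priority function $p:S\to D$ maps states to non-negative integers, $D$ a finite set of non-negative integers; $\mathsf{Parity}(p)$ is the set of plays $\rho$ such that $\min\{p(s)\mid s\in\mathrm{Inf}(\rho)\}$ is even, where $\mathrm{Inf}(\rho)$ is the set of states occurring infinitely often in $\rho$. A strategy $\sigma$ is almost-sure (resp. positive) winning for $\varphi$ if $\mathbb{P}^\sigma(\varphi)=1$ (resp. $>0$). The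 belief is the set of states in which the POMDP can be given the observation-action history; it is initially $\{s_0\}$ and is updated from $Y$ on action $a$ and observation $o$ to $\bigcup_{s\in Y}\mathrm{Supp}(\delta(s,a))\cap\gamma^{-1}(o)$. A (randomized) belief-based stationary strategy chooses a distribution over actions depending only on the current belief. *)

theory Defs
  imports "HOL-Probability.Probability"
begin

text \<open>
  The chain with initial distribution \<open>init\<close> and transition kernel \<open>K\<close>; the measure on its infinite
  paths is the Ionescu-Tulcea measure on the product of discrete spaces.
\<close>

locale markov_chain =
  fixes init :: "'c pmf" and K :: "'c \<Rightarrow> 'c pmf"
begin

definition kernel :: "nat \<Rightarrow> (nat \<Rightarrow> 'c) \<Rightarrow> 'c measure" where
  "kernel n \<omega> = measure_pmf (case n of 0 \<Rightarrow> init | Suc k \<Rightarrow> K (\<omega> k))"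

sublocale IT: Ionescu_Tulcea kernel "\<lambda>_. count_space UNIV"
proof (rule Ionescu_Tulcea.intro)
  fix i :: nat
  show "kernel i \<in> measurable (PiM {0..<i} (\<lambda>_. count_space UNIV)) (subprob_algebra (count_space UNIV))"
  proof (cases i)
    case 0
    then show ?thesis
      by (auto simp: kernel_def[abs_def] space_subprob_algebra measure_pmf.subprob_space_axioms)
  next
    case (Suc k)
    have "(\<lambda>c. measure_pmf (K c)) \<in> measurable (count_space UNIV) (subprob_algebra (count_space UNIV))"
      by (auto simp: space_subprob_algebra measure_pmf.subprob_space_axioms)
    then have "(\<lambda>\<omega>. measure_pmf (K (\<omega> k))) \<in>
        measurable (PiM {0..<i} (\<lambda>_. count_space UNIV)) (subprob_algebra (count_space UNIV))"
      by (rule measurable_compose[rotated]) (auto simp: Suc intro!: measurable_component_singleton)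
    then show ?thesis
      by (simp add: kernel_def[abs_def] Suc)
  qed
next
  fix i :: nat and x :: "nat \<Rightarrow> 'c"
  show "prob_space (kernel i x)"
    unfolding kernel_def by (rule measure_pmf.prob_space_axioms)
qed

definition paths :: "(nat \<Rightarrow> 'c) measure" where
  "paths = IT.PF.lim"

lemma sets_paths [measurable_cong]: "sets paths = sets (PiM UNIV (\<lambda>_. count_space UNIV))"
  by (simp add: paths_def)

lemma prob_space_paths: "prob_space paths"
proof
  have "emeasure IT.PF.lim (IT.PF.emb UNIV {} (space (PiM {} (\<lambda>_. count_space UNIV)))) =
      emeasure (IT.CI {}) (space (PiM {} (\<lambda>_. count_space UNIV)))"
    by (rule IT.lim) auto
  moreover have "IT.PF.emb UNIV {} (space (PiM {} (\<lambda>_. count_space (UNIV :: 'c set)))) = UNIV"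
    by (auto simp: prod_emb_def space_PiM)
  moreover have "emeasure (IT.CI {}) (space (PiM {} (\<lambda>_. count_space (UNIV :: 'c set)))) = 1"
    using prob_space.emeasure_space_1[OF IT.PF.prob_space_P[of "{}"]]
    by (simp add: IT.CI_def)
  ultimately show "emeasure paths (space paths) = 1"
    by (simp add: paths_def space_PiM)
qed

lemma emeasure_cylinder:
  "emeasure paths {\<omega>. \<forall>i\<le>n. \<omega> i = x i} =
    ennreal (pmf init (x 0) * (\<Prod>i<n. pmf (K (x i)) (x (Suc i))))"
proof -
  let ?M = "\<lambda>_::nat. count_space (UNIV :: 'c set)"
  let ?Y = "\<lambda>n. {\<lambda>i\<in>{0..<n}. x i}"
  have sp: "space (PiM J ?M) = extensional J" for J :: "nat set"
    by (simp add: space_PiM PiE_def)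
  have Y: "?Y n \<in> sets (PiM {0..<n} ?M)" for n
  proof -
    have "PiE {0..<n} (\<lambda>i. {restrict x {0..<n} i}) = ?Y n"
      by (rule PiE_singleton) (rule restrict_extensional)
    then show ?thesis
      using sets_PiM_I_finite[of "{0..<n}" "\<lambda>i. {restrict x {0..<n} i}" ?M] by simp
  qed
  have u: "(\<lambda>_. undefined) \<in> space (PiM {0..<0::nat} ?M)"
    by (simp add: space_PiM)
  have C: "emeasure (IT.C 0 m (\<lambda>_. undefined)) (?Y m) =
      (\<Prod>i<m. ennreal (case i of 0 \<Rightarrow> pmf init (x 0) | Suc k \<Rightarrow> pmf (K (x k)) (x (Suc k))))" for m
  proof (induction m)
    case 0
    then show ?case
      using Y[of 0] by (simp add: indicator_def restrict_def)
  next
    case (Suc m)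
    have mC: "space (IT.C 0 m (\<lambda>_. undefined)) = space (PiM {0..<m} ?M)"
      using IT.space_C[OF u, of m] by simp
    have sC: "sets (IT.C 0 m (\<lambda>_. undefined)) = sets (PiM {0..<m} ?M)"
      using IT.sets_C[OF u, of m] by simp
    let ?k = "case m of 0 \<Rightarrow> pmf init (x 0) | Suc k \<Rightarrow> pmf (K (x k)) (x (Suc k))"
    have eP: "emeasure (IT.eP m \<omega>) (?Y (Suc m)) = indicator (?Y m) \<omega> * ennreal ?k"
      if w: "\<omega> \<in> space (PiM {0..<m} ?M)" for \<omega>
    proof -
      have "\<omega> \<in> extensional {0..<m}"
        using w by (simp add: sp)
      then have "(\<lambda>c. fun_upd \<omega> m c) -` ?Y (Suc m) = (if \<omega> = (\<lambda>i\<in>{0..<m}. x i) then {x m} else {})"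
        by (auto simp: fun_eq_iff restrict_def extensional_def less_Suc_eq split: if_splits)
           (metis less_irrefl)+
      moreover have "emeasure (kernel m (\<lambda>i\<in>{0..<m}. x i)) {x m} = ennreal ?k"
        by (cases m) (simp_all add: kernel_def emeasure_pmf_single)
      ultimately show ?thesis
        using IT.emeasure_eP[OF w Y[of "Suc m"]] by (auto simp: indicator_def)
    qed
    have meP: "IT.eP m \<in> measurable (IT.C 0 m (\<lambda>_. undefined)) (subprob_algebra (PiM {0..<Suc m} ?M))"
      using IT.measurable_eP[of m] by (simp add: measurable_cong_sets[OF sC refl])
    have "emeasure (IT.C 0 (Suc m) (\<lambda>_. undefined)) (?Y (Suc m)) =
        (\<integral>\<^sup>+\<omega>. emeasure (IT.eP m \<omega>) (?Y (Suc m)) \<partial>IT.C 0 m (\<lambda>_. undefined))"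
      using emeasure_bind[OF _ meP Y[of "Suc m"]] by (simp add: mC)
    also have "\<dots> = (\<integral>\<^sup>+\<omega>. ennreal ?k * indicator (?Y m) \<omega> \<partial>IT.C 0 m (\<lambda>_. undefined))"
      by (rule nn_integral_cong) (simp add: mC eP mult.commute)
    also have "\<dots> = ennreal ?k * emeasure (IT.C 0 m (\<lambda>_. undefined)) (?Y m)"
      using Y[of m] by (subst nn_integral_cmult_indicator) (simp_all add: sC)
    finally show ?case
      using Suc.IH by (simp add: mult.commute del: restrict_apply)
  qed
  have emb: "{\<omega>. \<forall>i\<le>n. \<omega> i = x i} = IT.PF.emb UNIV {0..<Suc n} (?Y (Suc n))"
    by (auto simp: prod_emb_def fun_eq_iff restrict_def less_Suc_eq_le) metis
  have "emeasure paths {\<omega>. \<forall>i\<le>n. \<omega> i = x i} = emeasure (IT.CI {0..<Suc n}) (?Y (Suc n))"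
    unfolding paths_def emb by (rule IT.lim[OF _ Y]) simp
  also have "\<dots> = emeasure (IT.C 0 (Suc n) (\<lambda>_. undefined)) (?Y (Suc n))"
    using IT.emeasure_CI[OF order_refl Y, of "Suc n"]
      prod_emb_id[OF sets.sets_into_space[OF Y, unfolded space_PiM], of "Suc n"]
    by (simp del: restrict_apply)
  also have "\<dots> = ennreal (\<Prod>i<Suc n. case i of 0 \<Rightarrow> pmf init (x 0) | Suc k \<Rightarrow> pmf (K (x k)) (x (Suc k)))"
    unfolding C by (rule prod_ennreal) (simp split: nat.split)
  also have "(\<Prod>i<Suc n. case i of 0 \<Rightarrow> pmf init (x 0) | Suc k \<Rightarrow> pmf (K (x k)) (x (Suc k))) =
      pmf init (x 0) * (\<Prod>i<n. pmf (K (x i)) (x (Suc i)))"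
    by (simp add: prod.lessThan_Suc_shift del: prod.lessThan_Suc)
  finally show ?thesis .
qed

end

record ('s, 'a, 'o) pomdp =
  states :: "'s set"
  actions :: "'a set"
  trans :: "'s \<Rightarrow> 'a \<Rightarrow> 's pmf"
  observations :: "'o set"
  obs :: "'s \<Rightarrow> 'o"
  init_state :: 's

definition wf_pomdp :: "('s, 'a, 'o) pomdp \<Rightarrow> bool" where
  "wf_pomdp G \<longleftrightarrow>
     finite (states G) \<and> finite (actions G) \<and> finite (observations G) \<and>
     init_state G \<in> states G \<and>
     (\<forall>s\<in>states G. \<forall>a\<in>actions G. set_pmf (trans G s a) \<subseteq> states G) \<and>
     (\<forall>s\<in>states G. obs G s \<in> observations G) \<and>
     {s \<in> states G. obs G s = obs G (init_state G)} = {init_state G}"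

record ('m, 'a, 'o) strategy =
  memory :: "'m set"
  init_mem :: 'm
  select :: "'m \<Rightarrow> 'a pmf"
  update :: "'m \<Rightarrow> 'o \<Rightarrow> 'a \<Rightarrow> 'm pmf"

text \<open>
  Memory states may be renamed freely, so quantifying over the finite-memory strategies of \<open>G\<close>
  amounts to quantifying over those with \<open>'m = nat\<close>.
\<close>

definition fm_strategy :: "('s, 'a, 'o) pomdp \<Rightarrow> ('m, 'a, 'o) strategy \<Rightarrow> bool" where
  "fm_strategy G \<sigma> \<longleftrightarrow>
     finite (memory \<sigma>) \<and> init_mem \<sigma> \<in> memory \<sigma> \<and>
     (\<forall>m\<in>memory \<sigma>. set_pmf (select \<sigma> m) \<subseteq> actions G) \<and>
     (\<forall>m\<in>memory \<sigma>. \<forall>ob\<in>observations G. \<forall>a\<in>actions G. set_pmf (update \<sigma> m ob a) \<subseteq> memory \<sigma>)"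

text \<open>The Markov chain on states and memory states induced by a strategy.\<close>

definition induced_chain ::
    "('s, 'a, 'o) pomdp \<Rightarrow> ('m, 'a, 'o) strategy \<Rightarrow> 's \<times> 'm \<Rightarrow> ('s \<times> 'm) pmf" where
  "induced_chain G \<sigma> = (\<lambda>(s, m).
     do {
       a \<leftarrow> select \<sigma> m;
       s' \<leftarrow> trans G s a;
       m' \<leftarrow> update \<sigma> m (obs G s') a;
       return_pmf (s', m')
     })"

lemma pmf_induced_chain:
  assumes "finite (actions G)" "set_pmf (select \<sigma> m) \<subseteq> actions G"
  shows "pmf (induced_chain G \<sigma> (s, m)) (s', m') =
    (\<Sum>a\<in>actions G. pmf (select \<sigma> m) a * pmf (trans G s a) s' * pmf (update \<sigma> m (obs G s') a) m')"
proof -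
  have inner: "pmf (trans G s a \<bind> (\<lambda>t. update \<sigma> m (obs G t) a \<bind> (\<lambda>m''. return_pmf (t, m'')))) (s', m') =
      pmf (trans G s a) s' * pmf (update \<sigma> m (obs G s') a) m'" for a
  proof -
    have "pmf (update \<sigma> m (obs G t) a \<bind> (\<lambda>m''. return_pmf (t, m''))) (s', m') =
        indicator {s'} t * pmf (update \<sigma> m (obs G s') a) m'" for t
    proof (cases "t = s'")
      case True
      have "pmf (map_pmf (Pair s') (update \<sigma> m (obs G s') a)) (Pair s' m') = pmf (update \<sigma> m (obs G s') a) m'"
        by (rule pmf_map_inj') (simp add: inj_def)
      with True show ?thesis
        by (simp add: map_pmf_def)
    next
      case False
      then show ?thesis
        by (auto simp: pmf_eq_0_set_pmf)
    qed
    then show ?thesis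
      by (simp add: pmf_bind measure_pmf_single)
  qed
  show ?thesis
    using assms
    by (simp add: induced_chain_def pmf_bind[of "select \<sigma> m"] inner integral_measure_pmf[of "actions G"]
        subset_iff mult.assoc)
qed

text \<open>
  To obtain a measure on plays, which also contain the actions, the action drawn in the current step
  is recorded as a third component; forgetting it gives back the induced chain
  (\<open>induced_chain_eq_step\<close>).
\<close>

definition choose_action :: "('m, 'a, 'o) strategy \<Rightarrow> 's \<times> 'm \<Rightarrow> ('s \<times> 'm \<times> 'a) pmf" where
  "choose_action \<sigma> = (\<lambda>(s, m). map_pmf (\<lambda>a. (s, m, a)) (select \<sigma> m))"

definition step ::
    "('s, 'a, 'o) pomdp \<Rightarrow> ('m, 'a, 'o) strategy \<Rightarrow> 's \<times> 'm \<times> 'a \<Rightarrow> ('s \<times> 'm \<times> 'a) pmf" where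
  "step G \<sigma> = (\<lambda>(s, m, a).
     do {
       s' \<leftarrow> trans G s a;
       m' \<leftarrow> update \<sigma> m (obs G s') a;
       choose_action \<sigma> (s', m')
     })"

lemma induced_chain_eq_step:
  "induced_chain G \<sigma> x = map_pmf (\<lambda>(s, m, a). (s, m)) (choose_action \<sigma> x \<bind> step G \<sigma>)"
  by (cases x)
    (simp add: induced_chain_def choose_action_def step_def map_bind_pmf bind_map_pmf
      map_pmf_comp map_pmf_const)

text \<open>A play $(s_0, a_0, s_1, a_1, \ldots)$ is the function mapping $i$ to $(s_i, a_i)$.\<close>

type_synonym ('s, 'a) play = "nat \<Rightarrow> 's \<times> 'a"

definition play_measure ::
    "('s, 'a, 'o) pomdp \<Rightarrow> ('m, 'a, 'o) strategy \<Rightarrow> ('s, 'a) play measure" where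
  "play_measure G \<sigma> =
     distr (markov_chain.paths (choose_action \<sigma> (init_state G, init_mem \<sigma>)) (step G \<sigma>))
       (PiM UNIV (\<lambda>_. count_space UNIV))
       (\<lambda>\<omega> i. case \<omega> i of (s, m, a) \<Rightarrow> (s, a))"

lemma prob_space_play_measure:
  fixes G :: "('s, 'a, 'o) pomdp" and \<sigma> :: "('m, 'a, 'o) strategy"
  shows "prob_space (play_measure G \<sigma>)"
proof -
  let ?c = "choose_action \<sigma> (init_state G, init_mem \<sigma>)"
  have "(\<lambda>\<omega> i. case \<omega> i of (s, m, a) \<Rightarrow> (s, a)) \<in>
      measurable (PiM UNIV (\<lambda>_::nat. count_space (UNIV :: ('s \<times> 'm \<times> 'a) set))) (PiM UNIV (\<lambda>_. count_space UNIV))"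
    by (rule measurable_PiM_single')
       (auto intro!: measurable_compose[OF measurable_component_singleton])
  then show ?thesis
    unfolding play_measure_def
    by (intro prob_space.prob_space_distr markov_chain.prob_space_paths)
       (simp add: measurable_cong_sets[OF markov_chain.sets_paths refl])
qed

definition plays :: "('s, 'a, 'o) pomdp \<Rightarrow> ('s, 'a) play set" where
  "plays G = {\<rho>. fst (\<rho> 0) = init_state G \<and>
     (\<forall>i. fst (\<rho> i) \<in> states G \<and> snd (\<rho> i) \<in> actions G \<and>
          fst (\<rho> (Suc i)) \<in> set_pmf (trans G (fst (\<rho> i)) (snd (\<rho> i))))}"

definition inf_states :: "('s, 'a) play \<Rightarrow> 's set" where
  "inf_states \<rho> = {s. \<exists>\<^sub>\<infinity>i. fst (\<rho> i) = s}"

text \<open>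
  Along a play only the finitely many states of \<open>G\<close> occur, so the set below \<open>Min\<close> is finite and
  non-empty and the event is measurable even if the type of states is uncountable.
\<close>

definition parity_objective :: "('s, 'a, 'o) pomdp \<Rightarrow> ('s \<Rightarrow> nat) \<Rightarrow> ('s, 'a) play set" where
  "parity_objective G p = {\<rho> \<in> plays G. even (Min (p ` inf_states \<rho>))}"

definition almost_sure_winning ::
    "('s, 'a, 'o) pomdp \<Rightarrow> ('m, 'a, 'o) strategy \<Rightarrow> ('s, 'a) play set \<Rightarrow> bool" where
  "almost_sure_winning G \<sigma> \<phi> \<longleftrightarrow> measure (play_measure G \<sigma>) \<phi> = 1"

definition positive_winning ::
    "('s, 'a, 'o) pomdp \<Rightarrow> ('m, 'a, 'o) strategy \<Rightarrow> ('s, 'a) play set \<Rightarrow> bool" where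
  "positive_winning G \<sigma> \<phi> \<longleftrightarrow> measure (play_measure G \<sigma>) \<phi> > 0"

definition belief_update :: "('s, 'a, 'o) pomdp \<Rightarrow> 's set \<Rightarrow> 'a \<Rightarrow> 'o \<Rightarrow> 's set" where
  "belief_update G Y a ob = (\<Union>s\<in>Y. set_pmf (trans G s a)) \<inter> {s \<in> states G. obs G s = ob}"

text \<open>
  A belief-based stationary strategy, given by a map \<open>f\<close> from beliefs to distributions over actions,
  is the strategy that uses the beliefs as its memory.
\<close>

definition belief_strategy ::
    "('s, 'a, 'o) pomdp \<Rightarrow> ('s set \<Rightarrow> 'a pmf) \<Rightarrow> ('s set, 'a, 'o) strategy" where
  "belief_strategy G f =
     \<lparr> memory = Pow (states G),
       init_mem = {init_state G},
       select = f,
       update = (\<lambda>Y ob a. return_pmf (belief_update G Y a ob)) \<rparr>"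

text \<open>
  The number of bits of a fraction of natural numbers representing \<open>x\<close>; meaningful for non-negative
  rational \<open>x\<close> only, hence \<open>rational_pomdp\<close>.
\<close>

definition bit_size :: "real \<Rightarrow> nat" where
  "bit_size x = (LEAST k. \<exists>a b :: nat. a < 2 ^ k \<and> 0 < b \<and> b < 2 ^ k \<and> x = real a / real b)"

definition rational_pomdp :: "('s, 'a, 'o) pomdp \<Rightarrow> bool" where
  "rational_pomdp G \<longleftrightarrow>
     (\<forall>s\<in>states G. \<forall>a\<in>actions G. \<forall>t\<in>states G. pmf (trans G s a) t \<in> \<rat>)"

definition pomdp_size :: "('s, 'a, 'o) pomdp \<Rightarrow> nat" where
  "pomdp_size G = card (states G) + card (actions G) + card (observations G) +
     (\<Sum>s\<in>states G. \<Sum>a\<in>actions G. \<Sum>t\<in>set_pmf (trans G s a). bit_size (pmf (trans G s a) t))"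

end

theory Submission
  imports Defs
begin

text \<open>
  In a finite chain the set of states visited infinitely often is almost surely non-empty and closed
  under successors. Call a state of the induced chain settled at priority \<open>l\<close> if every state
  reachable from it has priority at least \<open>l\<close> and reaches one with priority \<open>l\<close>. A finite-memory
  strategy is positive winning iff some reachable state is settled at an even priority, and almost-sure
  winning iff every reachable state reaches such a state. Both conditions survive merging memory
  states \<open>m\<close> that agree, for every state \<open>s\<close>, on the even priority at which \<open>(s, m)\<close> is settled (if
  any) and on whether one wins almost surely from \<open>(s, m)\<close>: such properties are inherited along edges,
  and edges of the quotient lift. There are at most \<open>(d + 2)\<close> to the power \<open>|S|\<close> classes.

  For the lower bound, the strategy has to remember an arbitrary subset of an \<open>n\<close>-element set. For the
  insufficiency of beliefs, it has to alternate between two actions although the belief is constant.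
\<close>

subsection \<open>Recurrence in Markov chains\<close>

text \<open>Probability enters through two facts: a path almost surely visits every successor of a
  state that it visits infinitely often, and a finite path in the support has positive probability.
  Beyond them winning depends on the support graph alone, so a merged strategy may use any
  distributions with the right supports. The obstacle in merging is that a path of the quotient need
  not lift to a path, since each step may leave from another member of the class. What survives is a
  property inherited along edges and invariant under a change of member. For positive winning, being
  settled at a given even priority suffices. For almost-sure winning, the members met on the way may
  be unreachable in the original chain, so that winning from them has to be recorded as well. Odd
  priorities carry nothing that merging must preserve. This leaves \<open>d + 2\<close> labels per
  state, and \<open>d + 2 <= 2 ^ (3 * d)\<close> for \<open>d >= 1\<close>. Each of the two examples
  serves both winning modes: its strategy wins almost surely, whereas the limitation is shown for
  all positive winning strategies of the kind considered.\<close>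

context markov_chain
begin

lemma restrict_paths:
  "distr paths (PiM {0..<n} (\<lambda>_. count_space UNIV)) (\<lambda>\<omega>. restrict \<omega> {0..<n}) = IT.C 0 n (\<lambda>_. undefined)"
proof -
  have "IT.up_to {0..<n} = n"
    using IT.up_to_iff[of "{0..<n}"] by (metis antisym atLeastLessThan_iff finite_atLeastLessThan le0 not_less order_refl)
  then have "IT.CI {0..<n} = distr (IT.C 0 n (\<lambda>_. undefined)) (PiM {0..<0+n} (\<lambda>_. count_space UNIV)) (\<lambda>\<omega>. restrict \<omega> {0..<0+n})"
    by (simp add: IT.CI_def)
  also have "\<dots> = IT.C 0 n (\<lambda>_. undefined)"
    by (rule IT.distr_C[symmetric]) (simp_all add: space_PiM)
  finally show ?thesis
    unfolding paths_def by (subst IT.distr_lim) simp_all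
qed

text \<open>Integrating out the last coordinate first plays the part of the Markov property and
  avoids conditional expectations.\<close>

lemma nn_integral_paths_Suc:
  assumes f: "f \<in> borel_measurable (PiM {0..<Suc n} (\<lambda>_. count_space UNIV))"
  shows "(\<integral>\<^sup>+\<omega>. f (restrict \<omega> {0..<Suc n}) \<partial>paths) =
    (\<integral>\<^sup>+\<omega>. (\<integral>\<^sup>+y. f ((restrict \<omega> {0..<n})(n := y)) \<partial>kernel n (restrict \<omega> {0..<n})) \<partial>paths)"
proof -
  let ?M = "\<lambda>_::nat. count_space (UNIV :: 'c set)"
  let ?u = "\<lambda>_::nat. undefined :: 'c"
  have restr: "(\<lambda>\<omega>. restrict \<omega> {0..<k}) \<in> measurable paths (PiM {0..<k} ?M)" for k
    by (simp add: measurable_cong_sets[OF sets_paths refl] measurable_restrict_subset)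
  have u: "?u \<in> space (PiM {0..<0} ?M)"
    by (simp add: space_PiM)
  have sC: "sets (IT.C 0 n ?u) = sets (PiM {0..<n} ?M)"
    using IT.sets_C[OF u, of n] by simp
  have meP: "IT.eP n \<in> measurable (IT.C 0 n ?u) (subprob_algebra (PiM {0..<Suc n} ?M))"
    using IT.measurable_eP[of n] by (simp add: measurable_cong_sets[OF sC refl])
  have m: "(\<lambda>\<omega>. \<integral>\<^sup>+y. f y \<partial>IT.eP n \<omega>) \<in> borel_measurable (PiM {0..<n} ?M)"
    by (rule measurable_compose[OF IT.measurable_eP nn_integral_measurable_subprob_algebra[OF f]])
  have "(\<integral>\<^sup>+\<omega>. f (restrict \<omega> {0..<Suc n}) \<partial>paths) = (\<integral>\<^sup>+\<omega>. f \<omega> \<partial>IT.C 0 (Suc n) ?u)"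
    by (subst restrict_paths[symmetric], subst nn_integral_distr[OF restr]) (simp_all add: f)
  also have "\<dots> = (\<integral>\<^sup>+\<omega>. (\<integral>\<^sup>+y. f y \<partial>IT.eP n \<omega>) \<partial>IT.C 0 n ?u)"
    using nn_integral_bind[OF f meP] by simp
  also have "\<dots> = (\<integral>\<^sup>+\<omega>. (\<integral>\<^sup>+y. f y \<partial>IT.eP n (restrict \<omega> {0..<n})) \<partial>paths)"
    by (subst restrict_paths[symmetric], subst nn_integral_distr[OF restr]) (simp_all add: m)
  also have "\<dots> = (\<integral>\<^sup>+\<omega>. (\<integral>\<^sup>+y. f ((restrict \<omega> {0..<n})(n := y)) \<partial>kernel n (restrict \<omega> {0..<n})) \<partial>paths)"
    by (intro nn_integral_cong IT.nn_integral_eP[OF _ f]) (simp add: space_PiM)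
  finally show ?thesis .
qed

lemma measurable_paths_component [measurable]: "(\<lambda>\<omega>. \<omega> i) \<in> measurable paths (count_space UNIV)"
  by (simp add: measurable_cong_sets[OF sets_paths refl] measurable_component_singleton)

lemma AE_paths_0: "AE \<omega> in paths. \<omega> 0 \<in> set_pmf init"
proof -
  let ?f = "\<lambda>\<omega>. indicator (- set_pmf init) (\<omega> 0) :: ennreal"
  have "?f \<in> borel_measurable (PiM {0..<Suc 0} (\<lambda>_. count_space UNIV))"
    by (rule measurable_compose[OF measurable_component_singleton]) auto
  from nn_integral_paths_Suc[OF this]
  have "(\<integral>\<^sup>+\<omega>. ?f \<omega> \<partial>paths) = (\<integral>\<^sup>+\<omega>. emeasure init (- set_pmf init) \<partial>paths)"
    by (simp add: kernel_def)
  also have "emeasure init (- set_pmf init) = 0"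
    by (simp add: measure_pmf.emeasure_eq_measure measure_pmf_zero_iff)
  finally have "(\<integral>\<^sup>+\<omega>. ?f \<omega> \<partial>paths) = 0"
    by simp
  moreover have "?f \<in> borel_measurable paths"
    by (rule measurable_compose[OF measurable_paths_component]) auto
  ultimately have "AE \<omega> in paths. ?f \<omega> = 0"
    using nn_integral_0_iff_AE by blast
  then show ?thesis
    by eventually_elim (auto simp: indicator_def split: if_splits)
qed

text \<open>With \<open>x\<close> fixed, the bad event is a product of indicators of single
  coordinates, hence measurable even over an uncountable state type.\<close>

lemma AE_paths_Suc: "AE \<omega> in paths. \<omega> n = x \<longrightarrow> \<omega> (Suc n) \<in> set_pmf (K x)"
proof -
  let ?f = "\<lambda>\<omega>. indicator {x} (\<omega> n) * indicator (- set_pmf (K x)) (\<omega> (Suc n)) :: ennreal"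
  have "?f \<in> borel_measurable (PiM {0..<Suc (Suc n)} (\<lambda>_. count_space UNIV))"
    by (intro borel_measurable_times_ennreal measurable_compose[OF measurable_component_singleton]) auto
  from nn_integral_paths_Suc[OF this]
  have "(\<integral>\<^sup>+\<omega>. ?f \<omega> \<partial>paths) =
     (\<integral>\<^sup>+\<omega>. indicator {x} (\<omega> n) * emeasure (K (\<omega> n)) (- set_pmf (K x)) \<partial>paths)"
    by (simp add: kernel_def nn_integral_cmult)
  also have "\<dots> = (\<integral>\<^sup>+\<omega>. 0 \<partial>paths)"
    by (intro nn_integral_cong)
       (auto simp: indicator_def measure_pmf.emeasure_eq_measure measure_pmf_zero_iff)
  finally have "(\<integral>\<^sup>+\<omega>. ?f \<omega> \<partial>paths) = 0"
    by simp
  moreover have "?f \<in> borel_measurable paths"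
    by (intro borel_measurable_times_ennreal measurable_compose[OF measurable_paths_component]) auto
  ultimately have "AE \<omega> in paths. ?f \<omega> = 0"
    using nn_integral_0_iff_AE by blast
  then show ?thesis
    by eventually_elim (auto simp: indicator_def split: if_splits)
qed

text \<open>
  Along a path that never uses the edge from \<open>x\<close> to \<open>y\<close> after time \<open>n\<close>, the supermartingale
  \<open>Z\<close> below is multiplied by \<open>c > 1\<close> at every visit to \<open>x\<close>; by Fatou's lemma it almost surely
  does not tend to infinity.
\<close>

lemma AE_infinitely_often_successor:
  assumes y: "y \<in> set_pmf (K x)"
  shows "AE \<omega> in paths. (\<exists>\<^sub>\<infinity>i. \<omega> i = x) \<longrightarrow> (\<exists>\<^sub>\<infinity>i. \<omega> i = y)"
proof -
  define q where "q = pmf (K x) y"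
  have q: "0 < q" "q \<le> 1"
    using y by (auto simp: q_def pmf_positive pmf_le_1)
  \<comment> \<open>At a visit to \<open>x\<close> the factor has mean
    \<open>(1 + q) * (1 - q) = 1 - q ^ 2\<close>, at most 1. The exact compensator
    \<open>1 / (1 - q)\<close> would break down at \<open>q = 1\<close>.\<close>
  define g :: "'c \<Rightarrow> 'c \<Rightarrow> ennreal" where
    "g s t = (if s = x then (if t = y then 0 else ennreal (1 + q)) else 1)" for s t
  have g_le: "(\<integral>\<^sup>+t. g s t \<partial>K s) \<le> 1" for s
  proof (cases "s = x")
    case True
    have "(\<integral>\<^sup>+t. g s t \<partial>K s) = (\<integral>\<^sup>+t. ennreal (1 + q) * indicator (- {y}) t \<partial>K x)"
      unfolding True by (intro nn_integral_cong) (auto simp: g_def indicator_def)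
    also have "\<dots> = ennreal (1 + q) * emeasure (K x) (- {y})"
      by (simp add: nn_integral_cmult_indicator)
    also have "emeasure (K x) (- {y}) = ennreal (1 - q)"
      using measure_pmf.prob_compl[of "{y}" "K x"]
      by (simp add: measure_pmf.emeasure_eq_measure q_def measure_pmf_single Compl_eq_Diff_UNIV)
    also have "ennreal (1 + q) * ennreal (1 - q) = ennreal ((1 + q) * (1 - q))"
      using q by (simp add: ennreal_mult)
    also have "\<dots> \<le> 1"
      using q by (simp add: algebra_simps)
    finally show ?thesis .
  qed (simp add: g_def)
  define Z where "Z n N \<omega> = (\<Prod>i=n..<N. g (\<omega> i) (\<omega> (Suc i)))" for n N and \<omega> :: "nat \<Rightarrow> 'c"
  have g_meas: "(\<lambda>\<omega>. g (\<omega> i) (\<omega> (Suc i))) \<in> borel_measurable M"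
    if "\<And>j. j \<in> {i, Suc i} \<Longrightarrow> (\<lambda>\<omega>. \<omega> j) \<in> measurable M (count_space UNIV)" for i M
  proof -
    have [measurable]: "(\<lambda>\<omega>. \<omega> i) \<in> measurable M (count_space UNIV)"
       "(\<lambda>\<omega>. \<omega> (Suc i)) \<in> measurable M (count_space UNIV)"
      using that by auto
    show ?thesis unfolding g_def by measurable
  qed
  have Z_meas: "Z n N \<in> borel_measurable paths" for n N
    unfolding Z_def[abs_def] by (intro borel_measurable_prod_ennreal g_meas) simp
  have Z_le: "(\<integral>\<^sup>+\<omega>. Z n N \<omega> \<partial>paths) \<le> 1" if "n \<le> N" for n N
    using that
  proof (induction N rule: dec_induct)
    case base
    then show ?case
      using prob_space.emeasure_space_1[OF prob_space_paths] by (simp add: Z_def)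
  next
    case (step N)
    have m: "Z n (Suc N) \<in> borel_measurable (PiM {0..<Suc (Suc N)} (\<lambda>_. count_space UNIV))"
      unfolding Z_def[abs_def]
      by (intro borel_measurable_prod_ennreal g_meas measurable_component_singleton) auto
    have Z_Suc: "Z n (Suc N) \<omega> = Z n N \<omega> * g (\<omega> N) (\<omega> (Suc N))" for \<omega>
      using step by (simp add: Z_def prod.atLeastLessThan_Suc)
    \<comment> \<open>\<open>Z n N\<close> looks only at coordinates up to \<open>N\<close>, so the
      inner integral over coordinate \<open>Suc N\<close> treats it as a constant.\<close>
    have Z_cong: "Z n N \<omega> = Z n N \<omega>'" if "\<And>i. i \<le> N \<Longrightarrow> \<omega> i = \<omega>' i" for \<omega> \<omega>'
      unfolding Z_def using that by (intro prod.cong) auto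
    have "(\<integral>\<^sup>+\<omega>. Z n (Suc N) \<omega> \<partial>paths) = (\<integral>\<^sup>+\<omega>. Z n (Suc N) (restrict \<omega> {0..<Suc (Suc N)}) \<partial>paths)"
      by (intro nn_integral_cong) (auto simp: Z_def intro!: prod.cong)
    also have "\<dots> = (\<integral>\<^sup>+\<omega>. (\<integral>\<^sup>+t. Z n N \<omega> * g (\<omega> N) t \<partial>K (\<omega> N)) \<partial>paths)"
      by (subst nn_integral_paths_Suc[OF m], unfold Z_Suc, intro nn_integral_cong) (auto simp: kernel_def intro!: nn_integral_cong arg_cong2[where f="(*)"] Z_cong)
    also have "\<dots> = (\<integral>\<^sup>+\<omega>. Z n N \<omega> * (\<integral>\<^sup>+t. g (\<omega> N) t \<partial>K (\<omega> N)) \<partial>paths)"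
      by (simp add: nn_integral_cmult)
    also have "\<dots> \<le> (\<integral>\<^sup>+\<omega>. Z n N \<omega> * 1 \<partial>paths)"
      by (intro nn_integral_mono mult_left_mono g_le) simp
    finally show ?case
      using step.IH by simp
  qed
  have "AE \<omega> in paths. liminf (\<lambda>N. Z n N \<omega>) \<noteq> \<infinity>" for n
  proof (rule nn_integral_PInf_AE)
    show "(\<lambda>\<omega>. liminf (\<lambda>N. Z n N \<omega>)) \<in> borel_measurable paths"
      using Z_meas by simp
    have "(\<integral>\<^sup>+\<omega>. liminf (\<lambda>N. Z n N \<omega>) \<partial>paths) \<le> liminf (\<lambda>N. \<integral>\<^sup>+\<omega>. Z n N \<omega> \<partial>paths)"
      using Z_meas by (intro nn_integral_liminf)
    also have "\<dots> \<le> limsup (\<lambda>N. \<integral>\<^sup>+\<omega>. Z n N \<omega> \<partial>paths)"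
      by (rule Liminf_le_Limsup) simp
    also have "\<dots> \<le> 1"
      by (rule Limsup_bounded) (auto intro: eventually_sequentiallyI[of n] Z_le)
    finally show "(\<integral>\<^sup>+\<omega>. liminf (\<lambda>N. Z n N \<omega>) \<partial>paths) \<noteq> \<infinity>"
      by (auto simp: top_unique)
  qed
  then have AE: "AE \<omega> in paths. \<forall>n. liminf (\<lambda>N. Z n N \<omega>) \<noteq> \<infinity>"
    by (simp add: AE_all_countable)
  show ?thesis
  proof (rule eventually_mono[OF AE], intro impI, rule ccontr)
    fix \<omega> assume fin: "\<forall>n. liminf (\<lambda>N. Z n N \<omega>) \<noteq> \<infinity>"
      and x: "\<exists>\<^sub>\<infinity>i. \<omega> i = x" and "\<not> (\<exists>\<^sub>\<infinity>i. \<omega> i = y)"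
    then obtain n where n: "\<And>i. i \<ge> n \<Longrightarrow> \<omega> i \<noteq> y"
      by (auto simp: INFM_nat_le)
    let ?V = "\<lambda>N. {i\<in>{n..<N}. \<omega> i = x}"
    have Z_eq: "Z n N \<omega> = ennreal ((1 + q) ^ card (?V N))" for N
    proof -
      have "Z n N \<omega> = (\<Prod>i=n..<N. if \<omega> i = x then ennreal (1 + q) else 1)"
        unfolding Z_def using n by (intro prod.cong) (auto simp: g_def)
      also have "\<dots> = (\<Prod>i\<in>?V N. ennreal (1 + q))"
        by (subst prod.inter_filter) auto
      finally show ?thesis
        using q by (simp only: prod_constant) (simp add: ennreal_power[symmetric] del: ennreal_plus)
    qed
    have "infinite {i. n \<le> i \<and> \<omega> i = x}"
      using x unfolding INFM_nat_le
      by (metis (mono_tags, lifting) infinite_nat_iff_unbounded_le max.bounded_iff mem_Collect_eq)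
    then have "filterlim (\<lambda>N. card (?V N)) at_top sequentially"
    proof -
      assume inf: "infinite {i. n \<le> i \<and> \<omega> i = x}"
      show ?thesis
        unfolding filterlim_at_top
      proof
        fix k
        obtain F where F: "F \<subseteq> {i. n \<le> i \<and> \<omega> i = x}" "finite F" "card F = k"
          using infinite_arbitrarily_large[OF inf] by blast
        obtain N where N: "\<And>i. i \<in> F \<Longrightarrow> i < N"
          using finite_nat_bounded[OF F(2)] by blast
        have "k \<le> card (?V N')" if "N' \<ge> N" for N'
          using F N that by (auto intro!: card_mono dest!: less_le_trans)
        then show "\<forall>\<^sub>F N in sequentially. k \<le> card (?V N)"
          by (rule eventually_sequentiallyI)
      qed
    qed
    moreover have "filterlim (\<lambda>k. (1 + q) ^ k) at_top sequentially"
      using q by (intro filterlim_at_infinity_imp_filterlim_at_top filterlim_realpow_sequentially_gt1) auto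
    ultimately have "filterlim (\<lambda>N. (1 + q) ^ card (?V N)) at_top sequentially"
      by (rule filterlim_compose[rotated])
    then have "(\<lambda>N. Z n N \<omega>) \<longlonglongrightarrow> \<infinity>"
      unfolding Z_eq  by (simp add: ennreal_tendsto_top_eq_at_top)
    then have "liminf (\<lambda>N. Z n N \<omega>) = \<infinity>"
      by (intro lim_imp_Liminf) auto
    with fin show False
      by blast
  qed
qed

end

subsection \<open>Winning conditions on the induced chain\<close>

definition chain_rel ::
    "('s, 'a, 'o) pomdp \<Rightarrow> ('m, 'a, 'o) strategy \<Rightarrow> (('s \<times> 'm) \<times> ('s \<times> 'm)) set" where
  "chain_rel G \<sigma> = {(x, y). y \<in> set_pmf (induced_chain G \<sigma> x)}"

lemma chain_rel_iff:
  "((s, m), (s', m')) \<in> chain_rel G \<sigma> \<longleftrightarrow>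
    (\<exists>a\<in>set_pmf (select \<sigma> m). s' \<in> set_pmf (trans G s a) \<and> m' \<in> set_pmf (update \<sigma> m (obs G s') a))"
  by (auto simp: chain_rel_def induced_chain_def)

text \<open>With finitely many reachable states this means: no reachable priority is below
  \<open>l\<close>, and every reachable bottom strongly connected component has minimal priority
  \<open>l\<close>. Transient states can be settled too, and no components have to be
  formed.\<close>

definition settled :: "('x \<times> 'x) set \<Rightarrow> ('x \<Rightarrow> nat) \<Rightarrow> nat \<Rightarrow> 'x \<Rightarrow> bool" where
  "settled R p l x \<longleftrightarrow> (\<forall>y. (x, y) \<in> R\<^sup>* \<longrightarrow> l \<le> p y \<and> (\<exists>z. (y, z) \<in> R\<^sup>* \<and> p z = l))"

lemma settled_rtrancl: "settled R p l x \<Longrightarrow> (x, y) \<in> R\<^sup>* \<Longrightarrow> settled R p l y"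
  unfolding settled_def by (meson rtrancl_trans)

lemma settled_unique:
  assumes "settled R p l x" "settled R p k x"
  shows "l = k"
proof -
  have "k \<le> l" if l: "settled R p l x" and k: "settled R p k x" for l k
    using l k unfolding settled_def by (metis rtrancl.rtrancl_refl)
  from this[OF assms] this[OF assms(2,1)] show ?thesis
    by simp
qed

text \<open>A reachable state whose own reachable set is smallest lies in a bottom strongly
  connected component: whatever it reaches has the same reachable set, so the least priority there
  stays reachable.\<close>

lemma ex_settled:
  assumes fin: "finite (R\<^sup>* `` {x})"
  shows "\<exists>y l. (x, y) \<in> R\<^sup>* \<and> settled R p l y"
proof -
  have "\<exists>y. (x, y) \<in> R\<^sup>* \<and> (\<forall>z. (x, z) \<in> R\<^sup>* \<longrightarrow> card (R\<^sup>* `` {y}) \<le> card (R\<^sup>* `` {z}))"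
    by (rule ex_has_least_nat[of _ x]) simp
  then obtain y where y: "(x, y) \<in> R\<^sup>*"
    and min: "\<And>z. (x, z) \<in> R\<^sup>* \<Longrightarrow> card (R\<^sup>* `` {y}) \<le> card (R\<^sup>* `` {z})"
    by blast
  have fin_y: "finite (R\<^sup>* `` {y})"
    by (rule finite_subset[OF _ fin]) (use y in \<open>auto intro: rtrancl_trans\<close>)
  have eq: "R\<^sup>* `` {z} = R\<^sup>* `` {y}" if "(y, z) \<in> R\<^sup>*" for z
    using that y by (intro card_seteq fin_y min) (auto intro: rtrancl_trans)
  let ?l = "Min (p ` R\<^sup>* `` {y})"
  have "?l \<in> p ` R\<^sup>* `` {y}"
    using fin_y by (intro Min_in) auto
  then obtain w where w: "(y, w) \<in> R\<^sup>*" "p w = ?l"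
    by auto
  have "settled R p ?l y"
    unfolding settled_def
  proof (intro allI impI conjI)
    fix z assume z: "(y, z) \<in> R\<^sup>*"
    then show "?l \<le> p z"
      using fin_y by (intro Min_le) auto
    show "\<exists>w. (z, w) \<in> R\<^sup>* \<and> p w = ?l"
      using w eq[OF z] by auto
  qed
  with y show ?thesis
    by blast
qed

text \<open>Applied to the set \<open>I\<close> of pairs visited infinitely often: being closed, it
  contains all that its members reach, in particular a state of priority \<open>l\<close>.\<close>

lemma settled_Min:
  assumes st: "settled R p l x" and I: "I \<subseteq> R\<^sup>* `` {x}" "I \<noteq> {}" "finite I"
    and closed: "R `` I \<subseteq> I"
  shows "Min (p ` I) = l"
proof (rule Min_eqI)
  show "finite (p ` I)"
    using I by simp
  show "l \<le> k" if "k \<in> p ` I" for k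
    using that st I by (auto simp: settled_def)
  obtain y where y: "y \<in> I"
    using I by blast
  have I_rtrancl: "z \<in> I" if "(y, z) \<in> R\<^sup>*" "y \<in> I" for y z
    using that by induction (use closed in auto)
  obtain z where "(y, z) \<in> R\<^sup>*" "p z = l"
    using st y I by (auto simp: settled_def)
  with y I_rtrancl show "l \<in> p ` I"
    by blast
qed

lemma INFM_range_finite:
  fixes P :: "nat \<Rightarrow> bool"
  assumes "\<exists>\<^sub>\<infinity>i. P i" "\<And>i. f i \<in> A" "finite A"
  shows "\<exists>a\<in>A. \<exists>\<^sub>\<infinity>i. P i \<and> f i = a"
proof -
  have "\<exists>\<^sub>\<infinity>i. \<exists>a\<in>A. P i \<and> f i = a"
    using assms(1) by (rule INFM_mono) (use assms(2) in auto)
  then show ?thesis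
    using assms(3) by (subst (asm) INFM_finite_Bex_distrib)
qed

section \<open>Almost-sure behaviour of a single run\<close>

locale pomdp_strategy =
  fixes G :: "('s, 'a, 'o) pomdp" and \<sigma> :: "('m, 'a, 'o) strategy"
  assumes wf: "wf_pomdp G" and fm: "fm_strategy G \<sigma>"
begin

abbreviation x0 :: "'s \<times> 'm" where
  "x0 \<equiv> (init_state G, init_mem \<sigma>)"

abbreviation R :: "(('s \<times> 'm) \<times> ('s \<times> 'm)) set" where
  "R \<equiv> chain_rel G \<sigma>"

definition V :: "('s \<times> 'm) set" where
  "V = states G \<times> memory \<sigma>"

definition T :: "('s \<times> 'm \<times> 'a) set" where
  "T = {(s, m, a). s \<in> states G \<and> m \<in> memory \<sigma> \<and> a \<in> set_pmf (select \<sigma> m)}"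

definition pr :: "'s \<times> 'm \<times> 'a \<Rightarrow> 's \<times> 'm" where
  "pr = (\<lambda>(s, m, a). (s, m))"

lemma pr_simp [simp]: "pr (s, m, a) = (s, m)"
  by (simp add: pr_def)

lemma wfD:
  "finite (states G)" "finite (actions G)" "init_state G \<in> states G"
  "s \<in> states G \<Longrightarrow> a \<in> actions G \<Longrightarrow> set_pmf (trans G s a) \<subseteq> states G"
  "s \<in> states G \<Longrightarrow> obs G s \<in> observations G"
  using wf by (auto simp: wf_pomdp_def)

lemma fmD:
  "finite (memory \<sigma>)" "init_mem \<sigma> \<in> memory \<sigma>"
  "m \<in> memory \<sigma> \<Longrightarrow> set_pmf (select \<sigma> m) \<subseteq> actions G"
  "m \<in> memory \<sigma> \<Longrightarrow> ob \<in> observations G \<Longrightarrow> a \<in> actions G \<Longrightarrow> set_pmf (update \<sigma> m ob a) \<subseteq> memory \<sigma>"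
  using fm by (auto simp: fm_strategy_def)

lemma trans_states:
  "s' \<in> set_pmf (trans G s a) \<Longrightarrow> s \<in> states G \<Longrightarrow> m \<in> memory \<sigma> \<Longrightarrow> a \<in> set_pmf (select \<sigma> m) \<Longrightarrow>
    s' \<in> states G"
  using wfD(4) fmD(3) by blast

lemma update_memory:
  "m' \<in> set_pmf (update \<sigma> m (obs G s') a) \<Longrightarrow> s' \<in> states G \<Longrightarrow> m \<in> memory \<sigma> \<Longrightarrow>
    a \<in> set_pmf (select \<sigma> m) \<Longrightarrow> m' \<in> memory \<sigma>"
  using fmD(4)[OF _ wfD(5)] fmD(3) by blast

lemma finite_V: "finite V"
  using wfD fmD by (simp add: V_def)

lemma x0_V: "x0 \<in> V"
  using wfD fmD by (simp add: V_def)

lemma R_V: "(x, y) \<in> R \<Longrightarrow> x \<in> V \<Longrightarrow> y \<in> V"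
  by (cases x; cases y) (auto simp: V_def chain_rel_iff dest: trans_states update_memory)

lemma R_rtrancl_V: "(x, y) \<in> R\<^sup>* \<Longrightarrow> x \<in> V \<Longrightarrow> y \<in> V"
  by (induction rule: rtrancl_induct) (auto intro: R_V)

lemma finite_T: "finite T"
proof (rule finite_subset)
  show "T \<subseteq> states G \<times> memory \<sigma> \<times> actions G"
    using fmD by (auto simp: T_def)
qed (use wfD fmD in simp)

lemma step_iff:
  "(s', m', a') \<in> set_pmf (step G \<sigma> (s, m, a)) \<longleftrightarrow>
    s' \<in> set_pmf (trans G s a) \<and> m' \<in> set_pmf (update \<sigma> m (obs G s') a) \<and> a' \<in> set_pmf (select \<sigma> m')"
  by (auto simp: step_def choose_action_def)

lemma choose_action_iff:
  "(s', m', a') \<in> set_pmf (choose_action \<sigma> (s, m)) \<longleftrightarrow> s' = s \<and> m' = m \<and> a' \<in> set_pmf (select \<sigma> m)"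
  by (auto simp: choose_action_def)

lemma step_R: "t \<in> T \<Longrightarrow> u \<in> set_pmf (step G \<sigma> t) \<Longrightarrow> (pr t, pr u) \<in> R"
  by (cases t; cases u) (auto simp: step_iff chain_rel_iff T_def)

lemma step_T: "t \<in> T \<Longrightarrow> u \<in> set_pmf (step G \<sigma> t) \<Longrightarrow> u \<in> T"
  using R_V[OF step_R, of t u] by (cases t; cases u) (auto simp: step_iff T_def V_def)

sublocale mc: markov_chain "choose_action \<sigma> x0" "step G \<sigma>" .

text \<open>The properties of a path that hold almost surely and determine its outcome; what follows
  about such runs is purely combinatorial.\<close>

definition recurrent_run :: "(nat \<Rightarrow> 's \<times> 'm \<times> 'a) \<Rightarrow> bool" where
  "recurrent_run \<omega> \<longleftrightarrow> \<omega> 0 \<in> set_pmf (choose_action \<sigma> x0) \<and>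
     (\<forall>i. \<omega> i \<in> T \<and> \<omega> (Suc i) \<in> set_pmf (step G \<sigma> (\<omega> i))) \<and>
     (\<forall>t u. u \<in> set_pmf (step G \<sigma> t) \<longrightarrow> (\<exists>\<^sub>\<infinity>i. \<omega> i = t) \<longrightarrow> (\<exists>\<^sub>\<infinity>i. \<omega> i = u))"

text \<open>Null sets are united over the finite set \<open>T\<close> and over time; the unbounded
  quantifiers in \<open>recurrent_run\<close> are recovered because a run stays in
  \<open>T\<close>.\<close>

lemma AE_recurrent_run: "AE \<omega> in mc.paths. recurrent_run \<omega>"
proof -
  have "AE \<omega> in mc.paths. \<forall>t\<in>T. \<forall>n. \<omega> n = t \<longrightarrow> \<omega> (Suc n) \<in> set_pmf (step G \<sigma> t)"
    using finite_T by (simp add: AE_finite_all AE_all_countable mc.AE_paths_Suc)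
  moreover have "AE \<omega> in mc.paths. \<forall>t\<in>T. \<forall>u\<in>T. u \<in> set_pmf (step G \<sigma> t) \<longrightarrow>
      (\<exists>\<^sub>\<infinity>i. \<omega> i = t) \<longrightarrow> (\<exists>\<^sub>\<infinity>i. \<omega> i = u)"
    using finite_T by (auto simp: AE_finite_all intro!: AE_impI mc.AE_infinitely_often_successor)
  ultimately show ?thesis
    using mc.AE_paths_0
  proof eventually_elim
    case (elim \<omega>)
    have T: "\<omega> n \<in> T" for n
    proof (induction n)
      case 0
      then show ?case
        using elim(3) wfD fmD by (cases "\<omega> 0") (auto simp: choose_action_iff T_def)
    next
      case (Suc n)
      then show ?case
        using elim(1) step_T by blast
    qed
    have inf_T: "t \<in> T" if "\<exists>\<^sub>\<infinity>i. \<omega> i = t" for t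
    proof -
      have "\<exists>i. \<omega> i = t"
        using that by (rule INFM_EX)
      then show ?thesis
        using T by blast
    qed
    show ?case
      unfolding recurrent_run_def
    proof (intro conjI allI impI T elim(3))
      show "\<omega> (Suc i) \<in> set_pmf (step G \<sigma> (\<omega> i))" for i
        using elim(1) T by blast
      show "\<exists>\<^sub>\<infinity>i. \<omega> i = u" if "u \<in> set_pmf (step G \<sigma> t)" "\<exists>\<^sub>\<infinity>i. \<omega> i = t" for t u
        using elim(2) inf_T[OF that(2)] step_T[OF _ that(1)] that by blast
    qed
  qed
qed

context
  fixes \<omega> :: "nat \<Rightarrow> 's \<times> 'm \<times> 'a"
  assumes run: "recurrent_run \<omega>"
begin

lemma run_T: "\<omega> i \<in> T"
  using run unfolding recurrent_run_def by blast

lemma run_step: "\<omega> (Suc i) \<in> set_pmf (step G \<sigma> (\<omega> i))"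
  using run unfolding recurrent_run_def by blast

lemma run_inf: "u \<in> set_pmf (step G \<sigma> t) \<Longrightarrow> \<exists>\<^sub>\<infinity>i. \<omega> i = t \<Longrightarrow> \<exists>\<^sub>\<infinity>i. \<omega> i = u"
  using run unfolding recurrent_run_def by blast

lemma run_R: "i \<le> j \<Longrightarrow> (pr (\<omega> i), pr (\<omega> j)) \<in> R\<^sup>*"
proof (induction rule: dec_induct)
  case (step k)
  show ?case
    using step.IH step_R[OF run_T run_step, of k] by (rule rtrancl_into_rtrancl)
qed simp

lemma run_0: "pr (\<omega> 0) = x0"
proof -
  have "\<omega> 0 \<in> set_pmf (choose_action \<sigma> x0)"
    using run unfolding recurrent_run_def by blast
  then show ?thesis
    by (cases "\<omega> 0") (simp add: choose_action_iff)
qed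

definition inf_pairs :: "('s \<times> 'm) set" where
  "inf_pairs = {x. \<exists>\<^sub>\<infinity>i. pr (\<omega> i) = x}"

lemma inf_pairs_subset:
  assumes "(x, pr (\<omega> n)) \<in> R\<^sup>*"
  shows "inf_pairs \<subseteq> R\<^sup>* `` {x}"
proof
  fix y assume "y \<in> inf_pairs"
  then obtain i where "i \<ge> n" "pr (\<omega> i) = y"
    by (auto simp: inf_pairs_def INFM_nat_le)
  then show "y \<in> R\<^sup>* `` {x}"
    using rtrancl_trans[OF assms run_R[of n i]] by simp
qed

lemma finite_inf_pairs: "finite inf_pairs"
proof (rule finite_subset)
  show "inf_pairs \<subseteq> V"
    using inf_pairs_subset[of x0 0] R_rtrancl_V[OF _ x0_V] by (auto simp: run_0)
qed (rule finite_V)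

lemma inf_pairs_nonempty: "inf_pairs \<noteq> {}"
proof -
  have "\<exists>x\<in>pr ` T. \<exists>\<^sub>\<infinity>i. True \<and> pr (\<omega> i) = x"
    by (rule INFM_range_finite) (use run_T finite_T in auto)
  then obtain x where "\<exists>\<^sub>\<infinity>i. pr (\<omega> i) = x"
    by auto
  then have "x \<in> inf_pairs"
    by (simp add: inf_pairs_def)
  then show ?thesis
    by blast
qed

text \<open>
  An edge of the pair chain may use another action than the one recorded in the triple visited
  infinitely often; that triple has a predecessor visited infinitely often, which also leads to the
  triple with the required action.
\<close>

lemma inf_pairs_closed: "R `` inf_pairs \<subseteq> inf_pairs"
proof clarify
  fix s m s' m' assume "(s, m) \<in> inf_pairs" and "((s, m), (s', m')) \<in> R"
  then obtain a where inf: "\<exists>\<^sub>\<infinity>i. pr (\<omega> i) = (s, m)" and a: "a \<in> set_pmf (select \<sigma> m)"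
    and s': "s' \<in> set_pmf (trans G s a)" and m': "m' \<in> set_pmf (update \<sigma> m (obs G s') a)"
    by (auto simp: inf_pairs_def chain_rel_iff)
  have "\<exists>\<^sub>\<infinity>i. pr (\<omega> (Suc i)) = (s, m)"
    unfolding INFM_nat
  proof
    fix n
    obtain i where "i > Suc n" "pr (\<omega> i) = (s, m)"
      using inf unfolding INFM_nat by blast
    then show "\<exists>i>n. pr (\<omega> (Suc i)) = (s, m)"
      by (intro exI[of _ "i - 1"]) auto
  qed
  from INFM_range_finite[of _ \<omega> T, OF this run_T finite_T] obtain t
    where t: "\<exists>\<^sub>\<infinity>i. pr (\<omega> (Suc i)) = (s, m) \<and> \<omega> i = t"
    by blast
  then obtain i where "pr (\<omega> (Suc i)) = (s, m)" "\<omega> i = t"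
    using INFM_EX by blast
  then have "(s, m, a) \<in> set_pmf (step G \<sigma> t)"
    using run_step[of i] a by (cases t; cases "\<omega> (Suc i)") (auto simp: step_iff)
  moreover have "\<exists>\<^sub>\<infinity>i. \<omega> i = t"
    using t by (rule INFM_mono) simp
  ultimately have sma: "\<exists>\<^sub>\<infinity>i. \<omega> i = (s, m, a)"
    by (rule run_inf)
  obtain a' where "a' \<in> set_pmf (select \<sigma> m')"
    using set_pmf_not_empty[of "select \<sigma> m'"] by blast
  then have "(s', m', a') \<in> set_pmf (step G \<sigma> (s, m, a))"
    using s' m' by (simp add: step_iff)
  then have "\<exists>\<^sub>\<infinity>i. \<omega> i = (s', m', a')"
    using sma by (rule run_inf)
  then have "\<exists>\<^sub>\<infinity>i. pr (\<omega> i) = (s', m')"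
    by (rule INFM_mono) simp
  then show "(s', m') \<in> inf_pairs"
    by (simp add: inf_pairs_def)
qed

abbreviation play_of :: "('s, 'a) play" where
  "play_of \<equiv> (\<lambda>i. case \<omega> i of (s, m, a) \<Rightarrow> (s, a))"

lemma fst_play_of: "fst (play_of i) = fst (pr (\<omega> i))"
  by (cases "\<omega> i") simp

lemma play_of_plays: "play_of \<in> plays G"
  unfolding plays_def
proof (intro CollectI conjI allI)
  show "fst (play_of 0) = init_state G"
    by (simp add: fst_play_of run_0)
  fix i
  obtain s m a where i: "\<omega> i = (s, m, a)"
    by (cases "\<omega> i")
  obtain s' m' a' where Si: "\<omega> (Suc i) = (s', m', a')"
    by (cases "\<omega> (Suc i)")
  show "fst (play_of i) \<in> states G" "snd (play_of i) \<in> actions G"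
    using run_T[of i] fmD by (auto simp: i T_def)
  show "fst (play_of (Suc i)) \<in> set_pmf (trans G (fst (play_of i)) (snd (play_of i)))"
    using run_step[of i] by (simp add: i Si step_iff)
qed

text \<open>Here finiteness of the memory matters: by the pigeonhole principle, a state visited
  infinitely often is visited infinitely often with one and the same memory state.\<close>

lemma inf_states_play_of: "inf_states play_of = fst ` inf_pairs"
proof (intro equalityI subsetI)
  fix s assume "s \<in> inf_states play_of"
  then have "\<exists>\<^sub>\<infinity>i. fst (pr (\<omega> i)) = s"
    by (simp only: inf_states_def fst_play_of mem_Collect_eq)
  moreover have "pr (\<omega> i) \<in> pr ` T" for i
    using run_T by blast
  ultimately have "\<exists>x\<in>pr ` T. \<exists>\<^sub>\<infinity>i. fst (pr (\<omega> i)) = s \<and> pr (\<omega> i) = x"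
    using finite_T by (intro INFM_range_finite) auto
  then obtain x where x: "\<exists>\<^sub>\<infinity>i. fst (pr (\<omega> i)) = s \<and> pr (\<omega> i) = x"
    by blast
  then have "fst x = s"
    using INFM_EX[OF x] by auto
  moreover have "\<exists>\<^sub>\<infinity>i. pr (\<omega> i) = x"
    using x by (rule INFM_mono) simp
  then have "x \<in> inf_pairs"
    by (simp add: inf_pairs_def)
  ultimately show "s \<in> fst ` inf_pairs"
    by blast
next
  fix s assume "s \<in> fst ` inf_pairs"
  then obtain m where "\<exists>\<^sub>\<infinity>i. pr (\<omega> i) = (s, m)"
    by (auto simp: inf_pairs_def)
  then have "\<exists>\<^sub>\<infinity>i. fst (pr (\<omega> i)) = s"
    by (rule INFM_mono) simp
  then show "s \<in> inf_states play_of"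
    by (simp only: inf_states_def fst_play_of mem_Collect_eq)
qed

text \<open>Once a run has entered the region reachable from a settled pair, its outcome is
  decided.\<close>

lemma Min_inf_states_play_of:
  assumes "settled R (p \<circ> fst) l x" and "(x, pr (\<omega> n)) \<in> R\<^sup>*"
  shows "Min (p ` inf_states play_of) = l"
  using settled_Min[OF assms(1) inf_pairs_subset[OF assms(2)] inf_pairs_nonempty finite_inf_pairs inf_pairs_closed]
  by (simp add: inf_states_play_of image_comp)

end

end

text \<open>The predicate is general because the winning criteria play \<open>even\<close> off
  against \<open>odd\<close>.\<close>

definition min_objective :: "('s, 'a, 'o) pomdp \<Rightarrow> ('s \<Rightarrow> nat) \<Rightarrow> (nat \<Rightarrow> bool) \<Rightarrow> ('s, 'a) play set" where
  "min_objective G p Q = {\<rho> \<in> plays G. Q (Min (p ` inf_states \<rho>))}"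

lemma parity_objective_eq: "parity_objective G p = min_objective G p even"
  by (simp add: parity_objective_def min_objective_def)

text \<open>The set of states visited infinitely often takes only finitely many values along plays,
  and each value is described by countably many conditions on single coordinates.\<close>

lemma sets_min_objective:
  fixes G :: "('s, 'a, 'o) pomdp"
  assumes wf: "wf_pomdp G"
  shows "min_objective G p Q \<in> sets (PiM UNIV (\<lambda>_. count_space UNIV))"
proof -
  let ?M = "PiM UNIV (\<lambda>_::nat. count_space (UNIV :: ('s \<times> 'a) set))"
  let ?A = "states G \<times> actions G"
  have fin: "finite (states G)" "finite ?A"
    using wf by (auto simp: wf_pomdp_def)
  have comp [measurable]: "Measurable.pred ?M (\<lambda>\<rho>. P (\<rho> i))" for P :: "'s \<times> 'a \<Rightarrow> bool" and i :: nat
    by (rule measurable_compose[OF measurable_component_singleton]) auto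
  \<comment> \<open>The relation between consecutive coordinates is split over the finite set
    \<open>?A\<close>, since over an uncountable type it need not be measurable as a binary
    relation.\<close>
  have "plays G = {\<rho> \<in> space ?M. fst (\<rho> 0) = init_state G \<and>
      (\<forall>i. \<rho> i \<in> ?A \<and> (\<exists>x\<in>?A. \<rho> i = x \<and> fst (\<rho> (Suc i)) \<in> set_pmf (trans G (fst x) (snd x))))}"
    by (auto simp: plays_def space_PiM mem_Times_iff)
  also have "\<dots> \<in> sets ?M"
    using fin by measurable
  finally have plays: "plays G \<in> sets ?M" .
  define E where "E I = {\<rho> \<in> space ?M. \<forall>s\<in>states G. s \<in> I \<longleftrightarrow> (\<exists>\<^sub>\<infinity>i. fst (\<rho> i) = s)}" for I
  have E: "E I \<in> sets ?M" for I
    unfolding E_def INFM_nat using fin by measurable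
  have inf_states: "inf_states \<rho> \<subseteq> states G" if "\<rho> \<in> plays G" for \<rho>
    using that by (auto simp: inf_states_def plays_def dest!: INFM_EX)
  have "min_objective G p Q = (\<Union>I\<in>{I \<in> Pow (states G). Q (Min (p ` I))}. plays G \<inter> E I)" (is "?L = ?R")
  proof (intro equalityI subsetI)
    fix \<rho> assume "\<rho> \<in> ?L"
    then show "\<rho> \<in> ?R"
      using inf_states[of \<rho>] by (auto simp: min_objective_def E_def inf_states_def space_PiM)
  next
    fix \<rho> assume "\<rho> \<in> ?R"
    then obtain I where I: "I \<subseteq> states G" "Q (Min (p ` I))" "\<rho> \<in> plays G" "\<rho> \<in> E I"
      by blast
    then have "inf_states \<rho> = I"
      using inf_states[of \<rho>] by (auto simp: E_def inf_states_def)
    with I show "\<rho> \<in> ?L"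
      by (simp add: min_objective_def)
  qed
  also have "\<dots> \<in> sets ?M"
    using fin plays E by (intro sets.finite_UN) auto
  finally show ?thesis .
qed

section \<open>From runs to graph criteria for winning\<close>

context pomdp_strategy
begin

lemma measurable_play_of: "play_of \<in> measurable mc.paths (PiM UNIV (\<lambda>_. count_space UNIV))"
  by (rule measurable_PiM_single') (auto intro!: measurable_compose[OF mc.measurable_paths_component])

lemma AE_play_measure_iff:
  "(AE \<rho> in play_measure G \<sigma>. \<rho> \<in> min_objective G p Q) \<longleftrightarrow>
    (AE \<omega> in mc.paths. play_of \<omega> \<in> min_objective G p Q)"
proof -
  have "{\<rho> \<in> space (PiM UNIV (\<lambda>_. count_space UNIV)). \<rho> \<in> min_objective G p Q} = min_objective G p Q"
    by (auto simp: space_PiM)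
  then show ?thesis
    unfolding play_measure_def using sets_min_objective[OF wf, of p Q]
    by (subst AE_distr_iff[OF measurable_play_of]) auto
qed

lemma prob_play_measure_eq_1_iff:
  "measure (play_measure G \<sigma>) (min_objective G p Q) = 1 \<longleftrightarrow>
    (AE \<omega> in mc.paths. play_of \<omega> \<in> min_objective G p Q)"
proof -
  interpret prob_space "play_measure G \<sigma>"
    by (rule prob_space_play_measure)
  have "min_objective G p Q \<in> events"
    using sets_min_objective[OF wf] by (simp add: play_measure_def)
  then show ?thesis
    by (simp add: prob_eq_1 AE_play_measure_iff)
qed

lemma prob_play_measure_eq_0_iff:
  "measure (play_measure G \<sigma>) (min_objective G p Q) = 0 \<longleftrightarrow>
    (AE \<omega> in mc.paths. play_of \<omega> \<notin> min_objective G p Q)"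
proof -
  interpret prob_space "play_measure G \<sigma>"
    by (rule prob_space_play_measure)
  have ev: "min_objective G p Q \<in> events"
    using sets_min_objective[OF wf] by (simp add: play_measure_def)
  have eq: "{\<rho> \<in> space (PiM UNIV (\<lambda>_. count_space UNIV)). \<rho> \<notin> min_objective G p Q} =
      space (PiM UNIV (\<lambda>_. count_space UNIV)) - min_objective G p Q"
    by auto
  have "(AE \<rho> in play_measure G \<sigma>. \<rho> \<notin> min_objective G p Q) \<longleftrightarrow>
    (AE \<omega> in mc.paths. play_of \<omega> \<notin> min_objective G p Q)"
    unfolding play_measure_def using sets_min_objective[OF wf, of p Q]
    by (subst AE_distr_iff[OF measurable_play_of]) (auto simp: eq)
  then show ?thesis
    using prob_eq_0[OF ev] by simp
qed

text \<open>A recurrent run visits everything reachable from a pair that it visits infinitely often,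
  hence also a settled pair \<open>y\<close>, which fixes the minimum.\<close>

lemma AE_min_objective:
  assumes "\<And>x. (x0, x) \<in> R\<^sup>* \<Longrightarrow> \<exists>y l. (x, y) \<in> R\<^sup>* \<and> settled R (p \<circ> fst) l y \<and> Q l"
  shows "AE \<omega> in mc.paths. play_of \<omega> \<in> min_objective G p Q"
  using AE_recurrent_run
proof eventually_elim
  case (elim \<omega>)
  obtain x where x: "x \<in> inf_pairs \<omega>"
    using inf_pairs_nonempty[OF elim] by blast
  then have "(x0, x) \<in> R\<^sup>*"
    using inf_pairs_subset[OF elim, of x0 0] by (auto simp: run_0[OF elim])
  then obtain y l where y: "(x, y) \<in> R\<^sup>*" "settled R (p \<circ> fst) l y" "Q l"
    using assms by blast
  have "y \<in> inf_pairs \<omega>"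
    using y(1) x by induction (use inf_pairs_closed[OF elim] in auto)
  then obtain n where "pr (\<omega> n) = y"
    by (auto simp: inf_pairs_def[OF elim] dest!: INFM_EX)
  then have "Min (p ` inf_states (play_of \<omega>)) = l"
    using Min_inf_states_play_of[OF elim y(2), of n] by simp
  with y(3) play_of_plays[OF elim] show ?case
    by (simp add: min_objective_def)
qed

text \<open>The last action is arbitrary because, to prolong the path by an edge, the preceding
  triple must carry an action that realises this edge.\<close>

lemma ex_path:
  assumes "(x0, x) \<in> R\<^sup>*" "a \<in> set_pmf (select \<sigma> (snd x))"
  shows "\<exists>w n. w 0 \<in> set_pmf (choose_action \<sigma> x0) \<and>
    (\<forall>i<n. w (Suc i) \<in> set_pmf (step G \<sigma> (w i))) \<and> w n = (fst x, snd x, a)"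
  using assms
proof (induction arbitrary: a rule: rtrancl_induct)
  case base
  then show ?case
    by (intro exI[of _ "\<lambda>_. (fst x0, snd x0, a)"] exI[of _ 0]) (simp add: choose_action_iff)
next
  case (step x y)
  obtain s m s' m' where xy: "x = (s, m)" "y = (s', m')"
    by (cases x, cases y) auto
  obtain b where b: "b \<in> set_pmf (select \<sigma> m)" "s' \<in> set_pmf (trans G s b)"
    "m' \<in> set_pmf (update \<sigma> m (obs G s') b)"
    using step.hyps(2) by (auto simp: xy chain_rel_iff)
  obtain w n where w: "w 0 \<in> set_pmf (choose_action \<sigma> x0)"
    "\<forall>i<n. w (Suc i) \<in> set_pmf (step G \<sigma> (w i))" "w n = (s, m, b)"
    using step.IH[of b] b(1) by (auto simp: xy)
  have "(s', m', a) \<in> set_pmf (step G \<sigma> (w n))"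
    using b step.prems by (simp add: w(3) xy step_iff)
  then show ?case
    using w by (intro exI[of _ "w(Suc n := (s', m', a))"] exI[of _ "Suc n"]) (auto simp: xy less_Suc_eq)
qed

text \<open>The cylinder of a finite path to \<open>x\<close> has positive probability, and almost
  all paths in it have minimum \<open>l\<close>.\<close>

lemma prob_min_objective_pos:
  assumes x: "(x0, x) \<in> R\<^sup>*" "settled R (p \<circ> fst) l x" "Q l"
  shows "measure (play_measure G \<sigma>) (min_objective G p Q) \<noteq> 0"
proof
  assume "measure (play_measure G \<sigma>) (min_objective G p Q) = 0"
  then have AE: "AE \<omega> in mc.paths. play_of \<omega> \<notin> min_objective G p Q"
    by (simp add: prob_play_measure_eq_0_iff)
  obtain a where "a \<in> set_pmf (select \<sigma> (snd x))"
    using set_pmf_not_empty by fast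
  from ex_path[OF x(1) this] obtain w n where w: "w 0 \<in> set_pmf (choose_action \<sigma> x0)"
    "\<forall>i<n. w (Suc i) \<in> set_pmf (step G \<sigma> (w i))" "w n = (fst x, snd x, a)"
    by blast
  let ?C = "{\<omega>. \<forall>i\<le>n. \<omega> i = w i}"
  have "AE \<omega> in mc.paths. \<omega> \<notin> ?C"
    using AE_recurrent_run AE
  proof eventually_elim
    case (elim \<omega>)
    show ?case
    proof
      assume "\<omega> \<in> ?C"
      then have "pr (\<omega> n) = x"
        using w(3) by simp
      then have "Min (p ` inf_states (play_of \<omega>)) = l"
        using Min_inf_states_play_of[OF elim(1) x(2), of n] by simp
      then have "play_of \<omega> \<in> min_objective G p Q"
        using play_of_plays[OF elim(1)] x(3) by (simp add: min_objective_def)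
      with elim(2) show False
        by contradiction
    qed
  qed
  moreover have "{\<omega> \<in> space mc.paths. \<not> \<omega> \<notin> ?C} = ?C"
    using sets_eq_imp_space_eq[OF mc.sets_paths] by (auto simp: space_PiM)
  moreover have "?C \<in> sets mc.paths"
  proof -
    have "{\<omega> \<in> space mc.paths. \<forall>i\<le>n. \<omega> i = w i} \<in> sets mc.paths"
      by measurable
    then show ?thesis
      using sets_eq_imp_space_eq[OF mc.sets_paths] by (simp add: space_PiM)
  qed
  ultimately have "emeasure mc.paths ?C = 0"
    by (subst (asm) AE_iff_measurable) auto
  moreover have "0 < pmf (choose_action \<sigma> x0) (w 0) * (\<Prod>i<n. pmf (step G \<sigma> (w i)) (w (Suc i)))"
    using w by (intro mult_pos_pos prod_pos) (auto simp: pmf_positive)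
  ultimately show False
    by (metis mc.emeasure_cylinder ennreal_eq_0_iff not_le)
qed

lemma ex_settled_V:
  assumes "(x0, x) \<in> R\<^sup>*"
  shows "\<exists>y l. (x, y) \<in> R\<^sup>* \<and> settled R q l y"
proof (rule ex_settled)
  have "R\<^sup>* `` {x} \<subseteq> V"
    using R_rtrancl_V[OF assms x0_V] R_rtrancl_V by blast
  then show "finite (R\<^sup>* `` {x})"
    using finite_V by (rule finite_subset)
qed

text \<open>If no reachable pair is settled at an even priority, then those settled pairs that every
  reachable pair can reach are all odd, and the minimum is almost surely odd.\<close>

lemma positive_winning_iff:
  "positive_winning G \<sigma> (parity_objective G p) \<longleftrightarrow>
    (\<exists>x l. (x0, x) \<in> R\<^sup>* \<and> settled R (p \<circ> fst) l x \<and> even l)"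
proof
  show "positive_winning G \<sigma> (parity_objective G p)"
    if "\<exists>x l. (x0, x) \<in> R\<^sup>* \<and> settled R (p \<circ> fst) l x \<and> even l"
    using that prob_min_objective_pos[of _ p _ even]
    by (auto simp: positive_winning_def parity_objective_eq less_le)
  assume "positive_winning G \<sigma> (parity_objective G p)"
  then have pos: "measure (play_measure G \<sigma>) (min_objective G p even) \<noteq> 0"
    by (simp add: positive_winning_def parity_objective_eq)
  show "\<exists>x l. (x0, x) \<in> R\<^sup>* \<and> settled R (p \<circ> fst) l x \<and> even l"
  proof (rule ccontr)
    assume neg: "\<not> ?thesis"
    have "AE \<omega> in mc.paths. play_of \<omega> \<in> min_objective G p odd"
    proof (rule AE_min_objective)
      fix x assume x: "(x0, x) \<in> R\<^sup>*"
      from ex_settled_V[OF x] obtain y l where y: "(x, y) \<in> R\<^sup>*" "settled R (p \<circ> fst) l y"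
        by blast
      then show "\<exists>y l. (x, y) \<in> R\<^sup>* \<and> settled R (p \<circ> fst) l y \<and> odd l"
        using neg rtrancl_trans[OF x y(1)] by blast
    qed
    then have "AE \<omega> in mc.paths. play_of \<omega> \<notin> min_objective G p even"
      by (rule eventually_mono) (simp add: min_objective_def)
    with pos show False
      by (simp add: prob_play_measure_eq_0_iff)
  qed
qed

text \<open>Every reachable pair reaches a settled one; were its priority odd, the odd objective
  would have positive probability.\<close>

lemma almost_sure_winning_iff:
  "almost_sure_winning G \<sigma> (parity_objective G p) \<longleftrightarrow>
    (\<forall>x. (x0, x) \<in> R\<^sup>* \<longrightarrow> (\<exists>y l. (x, y) \<in> R\<^sup>* \<and> settled R (p \<circ> fst) l y \<and> even l))"
proof
  show "almost_sure_winning G \<sigma> (parity_objective G p)"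
    if "\<forall>x. (x0, x) \<in> R\<^sup>* \<longrightarrow> (\<exists>y l. (x, y) \<in> R\<^sup>* \<and> settled R (p \<circ> fst) l y \<and> even l)"
    unfolding almost_sure_winning_def parity_objective_eq prob_play_measure_eq_1_iff
    by (rule AE_min_objective) (use that in blast)
  assume "almost_sure_winning G \<sigma> (parity_objective G p)"
  then have "AE \<omega> in mc.paths. play_of \<omega> \<in> min_objective G p even"
    by (simp add: almost_sure_winning_def parity_objective_eq prob_play_measure_eq_1_iff)
  then have "AE \<omega> in mc.paths. play_of \<omega> \<notin> min_objective G p odd"
    by (rule eventually_mono) (simp add: min_objective_def)
  then have zero: "measure (play_measure G \<sigma>) (min_objective G p odd) = 0"
    by (simp add: prob_play_measure_eq_0_iff)
  show "\<forall>x. (x0, x) \<in> R\<^sup>* \<longrightarrow> (\<exists>y l. (x, y) \<in> R\<^sup>* \<and> settled R (p \<circ> fst) l y \<and> even l)"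
  proof (intro allI impI)
    fix x assume x: "(x0, x) \<in> R\<^sup>*"
    from ex_settled_V[OF x] obtain y l where y: "(x, y) \<in> R\<^sup>*" "settled R (p \<circ> fst) l y"
      by blast
    moreover have "even l"
      using prob_min_objective_pos[OF rtrancl_trans[OF x y(1)] y(2), of odd] zero by blast
    ultimately show "\<exists>y l. (x, y) \<in> R\<^sup>* \<and> settled R (p \<circ> fst) l y \<and> even l"
      by blast
  qed
qed

end

subsection \<open>Merging memory states\<close>

text \<open>Uniform distributions realise the desired supports. For an action that no member of the
  class plays, staying in \<open>k\<close> is a default that keeps \<open>update\<close> within
  \<open>memory\<close>.\<close>

definition quotient_strategy ::
    "('m, 'a, 'o) strategy \<Rightarrow> ('m \<Rightarrow> 'k) \<Rightarrow> ('k, 'a, 'o) strategy" where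
  "quotient_strategy \<sigma> q =
     \<lparr> memory = q ` memory \<sigma>,
       init_mem = q (init_mem \<sigma>),
       select = (\<lambda>k. pmf_of_set (\<Union>m\<in>{m \<in> memory \<sigma>. q m = k}. set_pmf (select \<sigma> m))),
       update = (\<lambda>k ob a.
         let M = {m \<in> memory \<sigma>. q m = k \<and> a \<in> set_pmf (select \<sigma> m)}
         in if M = {} then return_pmf k
            else pmf_of_set (\<Union>m\<in>M. q ` set_pmf (update \<sigma> m ob a))) \<rparr>"

context pomdp_strategy
begin

lemma set_pmf_select_quotient:
  assumes "k \<in> q ` memory \<sigma>"
  shows "set_pmf (select (quotient_strategy \<sigma> q) k) =
    (\<Union>m\<in>{m \<in> memory \<sigma>. q m = k}. set_pmf (select \<sigma> m))"
proof -
  have "finite (\<Union>m\<in>{m \<in> memory \<sigma>. q m = k}. set_pmf (select \<sigma> m))"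
    by (rule finite_subset[OF _ wfD(2)]) (use fmD in blast)
  moreover have "(\<Union>m\<in>{m \<in> memory \<sigma>. q m = k}. set_pmf (select \<sigma> m)) \<noteq> {}"
    using assms set_pmf_not_empty by fast
  ultimately show ?thesis
    by (simp add: quotient_strategy_def)
qed

lemma set_pmf_update_quotient:
  assumes "m \<in> memory \<sigma>" "q m = k" "a \<in> set_pmf (select \<sigma> m)" "ob \<in> observations G"
  shows "set_pmf (update (quotient_strategy \<sigma> q) k ob a) =
    (\<Union>m\<in>{m \<in> memory \<sigma>. q m = k \<and> a \<in> set_pmf (select \<sigma> m)}. q ` set_pmf (update \<sigma> m ob a))"
proof -
  have a: "a \<in> actions G"
    using assms fmD by blast
  let ?M = "{m \<in> memory \<sigma>. q m = k \<and> a \<in> set_pmf (select \<sigma> m)}"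
  have fin: "finite (\<Union>m\<in>?M. q ` set_pmf (update \<sigma> m ob a))"
  proof (rule finite_subset)
    show "(\<Union>m\<in>?M. q ` set_pmf (update \<sigma> m ob a)) \<subseteq> q ` memory \<sigma>"
      using fmD(4)[OF _ assms(4) a] by blast
  qed (use fmD in simp)
  have ne: "(\<Union>m\<in>?M. q ` set_pmf (update \<sigma> m ob a)) \<noteq> {}"
    using assms set_pmf_not_empty by fast
  have "?M \<noteq> {}"
    using assms by blast
  then have "update (quotient_strategy \<sigma> q) k ob a =
      pmf_of_set (\<Union>m\<in>?M. q ` set_pmf (update \<sigma> m ob a))"
    by (simp only: quotient_strategy_def Let_def strategy.simps if_False)
  then show ?thesis
    using set_pmf_of_set[OF ne fin] by simp
qed

lemma fm_quotient: "fm_strategy G (quotient_strategy \<sigma> q)"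
proof -
  let ?Q = "quotient_strategy \<sigma> q"
  have mem: "memory ?Q = q ` memory \<sigma>" "init_mem ?Q = q (init_mem \<sigma>)"
    by (simp_all add: quotient_strategy_def)
  have sel: "set_pmf (select ?Q k) \<subseteq> actions G" if "k \<in> q ` memory \<sigma>" for k
    using fmD by (subst set_pmf_select_quotient[OF that]) blast
  have upd: "set_pmf (update ?Q k ob a) \<subseteq> q ` memory \<sigma>"
    if k: "k \<in> q ` memory \<sigma>" "ob \<in> observations G" "a \<in> actions G" for k ob a
  proof (cases "\<exists>m\<in>memory \<sigma>. q m = k \<and> a \<in> set_pmf (select \<sigma> m)")
    case True
    then obtain m where m: "m \<in> memory \<sigma>" "q m = k" "a \<in> set_pmf (select \<sigma> m)"
      by blast
    show ?thesis
      using fmD(4)[OF _ k(2,3)] by (subst set_pmf_update_quotient[of m q k a, OF m k(2)]) blast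
  next
    case False
    then have "{m \<in> memory \<sigma>. q m = k \<and> a \<in> set_pmf (select \<sigma> m)} = {}"
      by blast
    then show ?thesis
      using k by (simp add: quotient_strategy_def)
  qed
  show ?thesis
    unfolding fm_strategy_def mem using fmD sel upd by simp
qed

text \<open>
  Since \<open>update\<close> only follows memory states of the class that may have played the action, every edge
  of the quotient chain is the image of an edge of the original one.
\<close>

lemma chain_rel_quotient_iff:
  assumes "s \<in> states G" "k \<in> q ` memory \<sigma>"
  shows "((s, k), (s', k')) \<in> chain_rel G (quotient_strategy \<sigma> q) \<longleftrightarrow>
    (\<exists>m m'. m \<in> memory \<sigma> \<and> q m = k \<and> q m' = k' \<and> ((s, m), (s', m')) \<in> R)" (is "?L \<longleftrightarrow> ?R")
proof
  assume ?L
  then obtain a where a: "a \<in> set_pmf (select (quotient_strategy \<sigma> q) k)"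
    and s': "s' \<in> set_pmf (trans G s a)"
    and k': "k' \<in> set_pmf (update (quotient_strategy \<sigma> q) k (obs G s') a)"
    by (auto simp: chain_rel_iff)
  obtain m where m: "m \<in> memory \<sigma>" "q m = k" "a \<in> set_pmf (select \<sigma> m)"
    using a by (auto simp: set_pmf_select_quotient[OF assms(2)])
  have "s' \<in> states G"
    using trans_states[OF s' assms(1) m(1,3)] .
  then show ?R
    using k' s' by (auto simp: set_pmf_update_quotient[of m q k a, OF m wfD(5)] chain_rel_iff)
next
  assume ?R
  then obtain m m' a where m: "m \<in> memory \<sigma>" "q m = k" "a \<in> set_pmf (select \<sigma> m)"
    and s': "s' \<in> set_pmf (trans G s a)"
    and m': "q m' = k'" "m' \<in> set_pmf (update \<sigma> m (obs G s') a)"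
    by (auto simp: chain_rel_iff)
  have "s' \<in> states G"
    using trans_states[OF s' assms(1) m(1,3)] .
  then have "k' \<in> set_pmf (update (quotient_strategy \<sigma> q) k (obs G s') a)"
    using m m' by (auto simp: set_pmf_update_quotient[of m q k a, OF m wfD(5)])
  moreover have "a \<in> set_pmf (select (quotient_strategy \<sigma> q) k)"
    using m by (auto simp: set_pmf_select_quotient[OF assms(2)])
  ultimately show ?L
    using s' by (auto simp: chain_rel_iff)
qed

section \<open>Properties of pairs that survive merging\<close>

definition even_settled :: "('s \<Rightarrow> nat) \<Rightarrow> nat \<Rightarrow> 's \<times> 'm \<Rightarrow> bool" where
  "even_settled p l x \<longleftrightarrow> settled R (p \<circ> fst) l x \<and> even l"

definition surely :: "('s \<Rightarrow> nat) \<Rightarrow> 's \<times> 'm \<Rightarrow> bool" where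
  "surely p x \<longleftrightarrow> (\<forall>y. (x, y) \<in> R\<^sup>* \<longrightarrow> (\<exists>z l. (y, z) \<in> R\<^sup>* \<and> even_settled p l z))"

lemma even_settled_step: "even_settled p l x \<Longrightarrow> (x, y) \<in> R \<Longrightarrow> even_settled p l y"
  by (auto simp: even_settled_def intro: settled_rtrancl)

lemma surely_step: "surely p x \<Longrightarrow> (x, y) \<in> R \<Longrightarrow> surely p y"
  unfolding surely_def by (meson converse_rtrancl_into_rtrancl)

text \<open>Excludes some label combinations and so leaves \<open>d + 2\<close> labels per state
  instead of \<open>2 * (d + 1)\<close>.\<close>

lemma even_settled_imp_surely: "even_settled p l x \<Longrightarrow> surely p x"
  unfolding surely_def even_settled_def by (meson settled_rtrancl rtrancl.rtrancl_refl)

end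

locale pomdp_quotient = pomdp_strategy G \<sigma>
  for G :: "('s, 'a, 'o) pomdp" and \<sigma> :: "('m, 'a, 'o) strategy" +
  fixes q :: "'m \<Rightarrow> 'k" and p :: "'s \<Rightarrow> nat"
  assumes compatible: "\<And>m m' s l. m \<in> memory \<sigma> \<Longrightarrow> m' \<in> memory \<sigma> \<Longrightarrow> q m = q m' \<Longrightarrow> s \<in> states G \<Longrightarrow>
    (even_settled p l (s, m) \<longleftrightarrow> even_settled p l (s, m')) \<and> (surely p (s, m) \<longleftrightarrow> surely p (s, m'))"
begin

abbreviation Q :: "('k, 'a, 'o) strategy" where
  "Q \<equiv> quotient_strategy \<sigma> q"

abbreviation cls :: "'s \<times> 'm \<Rightarrow> 's \<times> 'k" where
  "cls \<equiv> map_prod id q"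

sublocale quot: pomdp_strategy G Q
  by unfold_locales (rule wf, rule fm_quotient)

lemma cls_x0: "quot.x0 = cls x0"
  by (simp add: quotient_strategy_def)

lemma cls_rtrancl: "(x, y) \<in> R\<^sup>* \<Longrightarrow> x \<in> V \<Longrightarrow> (cls x, cls y) \<in> quot.R\<^sup>*"
proof (induction rule: rtrancl_induct)
  case (step y z)
  have "y \<in> V"
    using R_rtrancl_V step by blast
  then have "(cls y, cls z) \<in> quot.R"
    using step.hyps(2) by (cases y; cases z) (auto simp: V_def chain_rel_quotient_iff)
  with step show ?case
    by (meson rtrancl.rtrancl_into_rtrancl)
qed simp

text \<open>At each step the representative may have to be exchanged for the member
  \<open>m1\<close> that owns the edge. So the path itself does not lift; only \<open>P\<close>
  travels along, through \<open>cong\<close> at the exchange and through \<open>P\<close> along the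
  edge.\<close>

lemma lift_rtrancl:
  assumes "(cls x, y') \<in> quot.R\<^sup>*" "x \<in> V" "P x"
    and P: "\<And>x y. x \<in> V \<Longrightarrow> P x \<Longrightarrow> (x, y) \<in> R \<Longrightarrow> P y"
    and cong: "\<And>x y. x \<in> V \<Longrightarrow> y \<in> V \<Longrightarrow> cls x = cls y \<Longrightarrow> P x \<Longrightarrow> P y"
  shows "\<exists>y\<in>V. cls y = y' \<and> P y"
  using assms(1)
proof (induction rule: rtrancl_induct)
  case base
  then show ?case
    using assms by blast
next
  case (step y' z')
  obtain y where y: "y \<in> V" "cls y = y'" "P y"
    using step.IH by blast
  obtain s m s' k' where [simp]: "y = (s, m)" "z' = (s', k')"
    by (cases y; cases z')
  have "y' = (s, q m)"
    using y by auto
  then obtain m1 m' where m: "m1 \<in> memory \<sigma>" "q m1 = q m" "q m' = k'" "((s, m1), (s', m')) \<in> R"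
    using step.hyps(2) y(1) by (auto simp: V_def chain_rel_quotient_iff)
  have V1: "(s, m1) \<in> V"
    using m(1) y(1) by (auto simp: V_def)
  moreover have "P (s, m1)"
    using cong[OF y(1) V1] m(2) y(3) by simp
  ultimately have "P (s', m')"
    using m(4) by (rule P)
  moreover have "(s', m') \<in> V"
    using m(4) V1 by (rule R_V)
  ultimately show ?case
    using m(3) by (intro bexI[of _ "(s', m')"]) simp_all
qed

lemma cong:
  assumes "x \<in> V" "y \<in> V" "cls x = cls y"
  shows even_settled_cong: "even_settled p l x \<Longrightarrow> even_settled p l y"
    and surely_cong: "surely p x \<Longrightarrow> surely p y"
proof -
  obtain s m m' where xy: "x = (s, m)" "y = (s, m')" "q m = q m'"
    using assms(3) by (cases x; cases y) auto
  have "m \<in> memory \<sigma>" "m' \<in> memory \<sigma>" "s \<in> states G"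
    using assms(1,2) by (auto simp: xy V_def)
  from compatible[OF this(1,2) xy(3) this(3), of l]
  show "even_settled p l x \<Longrightarrow> even_settled p l y" "surely p x \<Longrightarrow> surely p y"
    by (simp_all add: xy)
qed

text \<open>Each quotient state reachable from \<open>cls x\<close> has a representative settled at
  the same \<open>l\<close>, whose path to priority \<open>l\<close> projects back to the
  quotient.\<close>

lemma even_settled_cls:
  assumes x: "x \<in> V" "even_settled p l x"
  shows "settled quot.R (p \<circ> fst) l (cls x)"
  unfolding settled_def
proof (intro allI impI)
  fix y' assume "(cls x, y') \<in> quot.R\<^sup>*"
  then have "\<exists>y\<in>V. cls y = y' \<and> even_settled p l y"
    using x by (rule lift_rtrancl) (erule (1) even_settled_step, erule (3) even_settled_cong)
  then obtain y where y: "y \<in> V" "cls y = y'" "even_settled p l y"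
    by blast
  then obtain z where z: "(y, z) \<in> R\<^sup>*" "(p \<circ> fst) z = l" and "l \<le> (p \<circ> fst) y"
    unfolding even_settled_def settled_def by blast
  then show "l \<le> (p \<circ> fst) y' \<and> (\<exists>z'. (y', z') \<in> quot.R\<^sup>* \<and> (p \<circ> fst) z' = l)"
    using y cls_rtrancl[OF z(1) y(1)] by (intro conjI exI[of _ "cls z"]) auto
qed

lemma positive_winning_quotient:
  assumes "positive_winning G \<sigma> (parity_objective G p)"
  shows "positive_winning G Q (parity_objective G p)"
proof -
  obtain x l where x: "(x0, x) \<in> R\<^sup>*" "even_settled p l x"
    using assms by (auto simp: positive_winning_iff even_settled_def)
  then have "(quot.x0, cls x) \<in> quot.R\<^sup>*"
    unfolding cls_x0 using x0_V by (intro cls_rtrancl)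
  moreover have "settled quot.R (p \<circ> fst) l (cls x)" "even l"
    using even_settled_cls[OF R_rtrancl_V[OF x(1) x0_V] x(2)] x(2) by (auto simp: even_settled_def)
  ultimately show ?thesis
    unfolding quot.positive_winning_iff by blast
qed

text \<open>The representative obtained for \<open>x'\<close> need not be reachable from
  \<open>x0\<close>; this is why \<open>surely\<close> is part of the label and reachability alone
  would not do.\<close>

lemma almost_sure_winning_quotient:
  assumes "almost_sure_winning G \<sigma> (parity_objective G p)"
  shows "almost_sure_winning G Q (parity_objective G p)"
  unfolding quot.almost_sure_winning_iff
proof (intro allI impI)
  have "surely p x0"
    using assms by (simp add: almost_sure_winning_iff even_settled_def surely_def)
  fix x' assume "(quot.x0, x') \<in> quot.R\<^sup>*"
  then have "(cls x0, x') \<in> quot.R\<^sup>*"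
    by (simp add: cls_x0)
  then have "\<exists>x\<in>V. cls x = x' \<and> surely p x"
    using x0_V \<open>surely p x0\<close>
    by (rule lift_rtrancl) (erule (1) surely_step, erule (3) surely_cong)
  then obtain x where x: "x \<in> V" "cls x = x'" "surely p x"
    by blast
  then obtain y l where y: "(x, y) \<in> R\<^sup>*" "even_settled p l y"
    unfolding surely_def by blast
  have "(x', cls y) \<in> quot.R\<^sup>*"
    using cls_rtrancl[OF y(1) x(1)] x(2) by simp
  moreover have "settled quot.R (p \<circ> fst) l (cls y)" "even l"
    using even_settled_cls[OF R_rtrancl_V[OF y(1) x(1)] y(2)] y(2) by (auto simp: even_settled_def)
  ultimately show "\<exists>y l. (x', y) \<in> quot.R\<^sup>* \<and> settled quot.R (p \<circ> fst) l y \<and> even l"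
    by blast
qed

end

lemma add_2_le_power: "1 \<le> d \<Longrightarrow> d + 2 \<le> 2 ^ (3 * d)" for d :: nat
  by (induction d rule: dec_induct) (auto simp: power_add)

section \<open>Counting the classes\<close>

context pomdp_strategy
begin

text \<open>The set in the first component has at most one element, by
  \<open>settled_unique\<close>. Restriction to \<open>states G\<close> places labels in a finite
  function space that can be counted.\<close>

definition label :: "('s \<Rightarrow> nat) \<Rightarrow> 'm \<Rightarrow> 's \<Rightarrow> nat set \<times> bool" where
  "label p m = (\<lambda>s\<in>states G. ({l. even_settled p l (s, m)}, surely p (s, m)))"

lemma label_in:
  assumes D: "p ` states G \<subseteq> D" and m: "m \<in> memory \<sigma>"
  shows "label p m \<in> states G \<rightarrow>\<^sub>E insert ({}, False) (insert ({}, True) ((\<lambda>l. ({l}, True)) ` D))"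
  unfolding label_def
proof (rule restrict_PiE_iff[THEN iffD2], intro ballI)
  fix s assume s: "s \<in> states G"
  show "({l. even_settled p l (s, m)}, surely p (s, m)) \<in>
      insert ({}, False) (insert ({}, True) ((\<lambda>l. ({l}, True)) ` D))"
  proof (cases "\<exists>l. even_settled p l (s, m)")
    case True
    then obtain l where l: "even_settled p l (s, m)"
      by blast
    then have "{l. even_settled p l (s, m)} = {l}"
      using settled_unique by (fastforce simp: even_settled_def)
    moreover obtain z where z: "((s, m), z) \<in> R\<^sup>*" "p (fst z) = l"
      using l unfolding even_settled_def settled_def o_apply by blast
    have "z \<in> V"
      using R_rtrancl_V[OF z(1)] s m by (simp add: V_def)
    then have "l \<in> D"
      using z(2) D by (auto simp: V_def)
    ultimately show ?thesis
      using even_settled_imp_surely[OF l] by simp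
  next
    case False
    then show ?thesis
      by auto
  qed
qed

text \<open>The given strategy may have any memory type and the result has memory in
  \<open>nat\<close>, so this also carries over strategies with structured memory.\<close>

theorem small_memory:
  assumes D: "finite D" "p ` states G \<subseteq> D"
  shows "\<exists>\<tau> :: (nat, 'a, 'o) strategy. fm_strategy G \<tau> \<and>
    card (memory \<tau>) \<le> 2 ^ (3 * card D * card (states G)) \<and>
    (positive_winning G \<sigma> (parity_objective G p) \<longrightarrow> positive_winning G \<tau> (parity_objective G p)) \<and>
    (almost_sure_winning G \<sigma> (parity_objective G p) \<longrightarrow> almost_sure_winning G \<tau> (parity_objective G p))"
proof -
  define L where "L = label p ` memory \<sigma>"
  have finL: "finite L"
    using fmD by (simp add: L_def)
  define q where "q = to_nat_on L \<circ> label p"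
  have q: "label p m = label p m'" if "m \<in> memory \<sigma>" "m' \<in> memory \<sigma>" "q m = q m'" for m m'
    using that inj_on_to_nat_on[OF countable_finite[OF finL]] by (auto simp: q_def L_def inj_on_def)
  interpret pomdp_quotient G \<sigma> q p
  proof unfold_locales
    fix m m' s l assume m: "m \<in> memory \<sigma>" "m' \<in> memory \<sigma>" "q m = q m'" and s: "s \<in> states G"
    have "label p m s = label p m' s"
      using q[OF m] by simp
    then show "(even_settled p l (s, m) \<longleftrightarrow> even_settled p l (s, m')) \<and> (surely p (s, m) \<longleftrightarrow> surely p (s, m'))"
      using s by (auto simp: label_def)
  qed
  let ?W = "insert ({}, False) (insert ({}, True) ((\<lambda>l. ({l}, True)) ` D)) :: (nat set \<times> bool) set"
  \<comment> \<open>The initial state has a priority. For \<open>d = 0\<close> the estimate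
    \<open>d + 2 <= 2 ^ (3 * d)\<close> would fail.\<close>
  have "card D \<ge> 1"
    using D wfD by (metis One_nat_def Suc_leI card_gt_0_iff empty_iff image_subset_iff)
  have "card ?W \<le> Suc (Suc (card ((\<lambda>l. ({l}, True)) ` D)))"
    using D(1) by (simp add: card_insert_if)
  also have "\<dots> \<le> card D + 2"
    using card_image_le[OF D(1)] by simp
  also have "\<dots> \<le> 2 ^ (3 * card D)"
    using \<open>card D \<ge> 1\<close> by (rule add_2_le_power)
  finally have W: "card ?W \<le> 2 ^ (3 * card D)" .
  have "card (memory Q) \<le> card L"
  proof -
    have "memory Q = to_nat_on L ` L"
      by (simp add: quotient_strategy_def q_def L_def image_comp)
    then show ?thesis
      using card_image_le[OF finL] by simp
  qed
  also have "\<dots> \<le> card (states G \<rightarrow>\<^sub>E ?W)"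
    using label_in[OF D(2)] wfD D by (intro card_mono finite_PiE) (auto simp: L_def)
  also have "\<dots> = card ?W ^ card (states G)"
    using wfD by (simp add: card_PiE)
  also have "\<dots> \<le> (2 ^ (3 * card D)) ^ card (states G)"
    using W by (rule power_mono) simp
  finally have "card (memory Q) \<le> 2 ^ (3 * card D * card (states G))"
    by (simp add: power_mult)
  then show ?thesis
    using fm_quotient positive_winning_quotient almost_sure_winning_quotient by blast
qed

end

subsection \<open>A POMDP without belief-based winning strategies\<close>

lemma almost_sure_imp_positive_winning:
  "almost_sure_winning G \<sigma> \<phi> \<Longrightarrow> positive_winning G \<sigma> \<phi>"
  by (simp add: almost_sure_winning_def positive_winning_def)

text \<open>
  State 1 expects action 0 and moves to state 2, state 2 expects action 1 and moves to state 1; the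
  wrong action leads to the error state 3, from which the play moves to 1 or 2. A strategy
  alternating the two actions is eventually in phase with the state, but states 1 to 3 share their
  observation and the belief does not reveal which action comes next.
\<close>

definition sync_succ :: "nat \<Rightarrow> nat \<Rightarrow> nat set" where
  "sync_succ s a =
     (if s = 0 then {1, 2, 3}
      else if s = 1 then (if a = 0 then {2} else {3})
      else if s = 2 then (if a = 0 then {3} else {1})
      else {1, 2})"

definition sync_pomdp :: "(nat, nat, nat) pomdp" where
  "sync_pomdp =
     \<lparr> states = {0, 1, 2, 3}, actions = {0, 1}, trans = (\<lambda>s a. pmf_of_set (sync_succ s a)),
       observations = {0, 1}, obs = (\<lambda>s. if s = 0 then 0 else 1), init_state = 0 \<rparr>"

definition sync_prio :: "nat \<Rightarrow> nat" where
  "sync_prio s = (if s = 3 then 1 else 2)"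

definition alternate :: "(nat, nat, nat) strategy" where
  "alternate = \<lparr> memory = {0, 1}, init_mem = 0, select = return_pmf,
     update = (\<lambda>m ob a. return_pmf (1 - m)) \<rparr>"

lemma set_pmf_trans_sync: "set_pmf (trans sync_pomdp s a) = sync_succ s a"
  by (simp add: sync_pomdp_def) (rule set_pmf_of_set, auto simp: sync_succ_def)

lemma wf_sync: "wf_pomdp sync_pomdp"
  unfolding wf_pomdp_def set_pmf_trans_sync
  by (auto simp: sync_pomdp_def sync_succ_def split: if_splits)

lemma sync_rel_alternate:
  "((s, m), (s', m')) \<in> chain_rel sync_pomdp alternate \<longleftrightarrow> s' \<in> sync_succ s m \<and> m' = 1 - m"
  by (simp add: chain_rel_iff set_pmf_trans_sync) (simp add: alternate_def)

lemma almost_sure_alternate: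
  "fm_strategy sync_pomdp alternate \<and>
    almost_sure_winning sync_pomdp alternate (parity_objective sync_pomdp sync_prio)"
proof
  show fm: "fm_strategy sync_pomdp alternate"
    by (auto simp: fm_strategy_def alternate_def sync_pomdp_def)
  interpret pomdp_strategy sync_pomdp alternate
    by unfold_locales (rule wf_sync, rule fm)
  \<comment> \<open>The two pairs in which the strategy is in phase; state 3 is never entered from
    them.\<close>
  have closed: "y \<in> {(1, 0), (2, 1)}" if "((1, 0), y) \<in> R\<^sup>*" for y
    using that by induction (auto simp: sync_rel_alternate sync_succ_def)
  have settled: "settled R (sync_prio \<circ> fst) 2 (1, 0)"
    unfolding settled_def
  proof (intro allI impI)
    fix y assume "((1, 0), y) \<in> R\<^sup>*"
    from closed[OF this] have "(sync_prio \<circ> fst) y = 2"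
      by (auto simp: sync_prio_def)
    then show "2 \<le> (sync_prio \<circ> fst) y \<and> (\<exists>z. (y, z) \<in> R\<^sup>* \<and> (sync_prio \<circ> fst) z = 2)"
      by (intro conjI exI[of _ y]) auto
  qed
  \<comment> \<open>The out-of-phase pairs \<open>(1, 1)\<close> and \<open>(2, 0)\<close> err once,
    and one of the two branches out of state 3 restores the phase. Hence all eight pairs reach
    \<open>(1, 0)\<close>.\<close>
  have edges: "((2, 1), (1, 0)) \<in> R" "((0, 0), (2, 1)) \<in> R" "((0, 1), (1, 0)) \<in> R" "((3, 0), (2, 1)) \<in> R"
    "((1, 1), (3, 0)) \<in> R" "((3, 1), (1, 0)) \<in> R" "((2, 0), (3, 1)) \<in> R"
    by (simp_all add: sync_rel_alternate sync_succ_def)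
  have r1: "((2, 1), (1, 0)) \<in> R\<^sup>*" "((0, 1), (1, 0)) \<in> R\<^sup>*" "((3, 1), (1, 0)) \<in> R\<^sup>*" "((1, 0), (1, 0)) \<in> R\<^sup>*"
    using edges by auto
  have r2: "((0, 0), (1, 0)) \<in> R\<^sup>*" "((3, 0), (1, 0)) \<in> R\<^sup>*" "((2, 0), (1, 0)) \<in> R\<^sup>*"
    using edges r1 converse_rtrancl_into_rtrancl by metis+
  have r3: "((1, 1), (1, 0)) \<in> R\<^sup>*"
    using edges(5) r2(2) by (rule converse_rtrancl_into_rtrancl)
  have "(x, (1, 0)) \<in> R\<^sup>*" if "(x0, x) \<in> R\<^sup>*" for x
  proof -
    have "x \<in> V"
      using R_rtrancl_V[OF that x0_V] .
    moreover have "V = {0, 1, 2, 3} \<times> {0, 1}"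
      by (simp only: V_def) (simp add: sync_pomdp_def alternate_def)
    ultimately show ?thesis
      using r1 r2 r3 by auto
  qed
  then show "almost_sure_winning sync_pomdp alternate (parity_objective sync_pomdp sync_prio)"
    unfolding almost_sure_winning_iff using settled by (metis dvd_refl)
qed

lemma belief_update_sync:
  assumes "a \<in> {0, 1}"
  shows "belief_update sync_pomdp {0} a (Suc 0) = {1, 2, 3}"
    and "belief_update sync_pomdp {1, 2, 3} a (Suc 0) = {1, 2, 3}"
  using assms unfolding belief_update_def set_pmf_trans_sync
  by (auto simp: sync_pomdp_def sync_succ_def)

text \<open>
  From the first step on the belief is \<open>{1, 2, 3}\<close>. Hence any action that a belief-based strategy
  plays with positive probability may be repeated, and repeating an action leads to state 3.
\<close>

lemma no_belief_strategy_sync: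
  assumes fm: "fm_strategy sync_pomdp (belief_strategy sync_pomdp f)"
  shows "\<not> positive_winning sync_pomdp (belief_strategy sync_pomdp f) (parity_objective sync_pomdp sync_prio)"
proof
  let ?\<sigma> = "belief_strategy sync_pomdp f"
  let ?Y = "{1, 2, 3} :: nat set"
  interpret pomdp_strategy sync_pomdp ?\<sigma>
    by unfold_locales (rule wf_sync, rule fm)
  have act: "set_pmf (f B) \<subseteq> {0, 1}" if "B \<subseteq> {0, 1, 2, 3}" for B
    using fmD(3)[of B] that by (simp add: belief_strategy_def sync_pomdp_def)
  have edge: "((s, B), (s', belief_update sync_pomdp B a (obs sync_pomdp s'))) \<in> R"
    if "a \<in> set_pmf (f B)" "s' \<in> sync_succ s a" for s s' a B
    using that by (auto simp: chain_rel_iff set_pmf_trans_sync belief_strategy_def)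
  have edge_iff: "((s, B), (s', B')) \<in> R \<longleftrightarrow>
      (\<exists>a\<in>set_pmf (f B). s' \<in> sync_succ s a \<and> B' = belief_update sync_pomdp B a (obs sync_pomdp s'))"
    for s s' B B'
    by (auto simp: chain_rel_iff set_pmf_trans_sync belief_strategy_def)
  have obs: "obs sync_pomdp s = Suc 0" if "s \<in> sync_succ t a" for s t a
    using that by (auto simp: sync_pomdp_def sync_succ_def split: if_splits)
  have succ_Y: "s' \<in> ?Y" if "s' \<in> sync_succ s a" for s s' a
    using that by (auto simp: sync_succ_def split: if_splits)
  have bu: "belief_update sync_pomdp B a (Suc 0) = ?Y" if "a \<in> set_pmf (f B)" "B \<in> {{0}, ?Y}" for a B
    using that act[of B] belief_update_sync[of a] by auto
  have R_Y: "((s, B), (s', ?Y)) \<in> R" if "a \<in> set_pmf (f B)" "s' \<in> sync_succ s a" "B \<in> {{0}, ?Y}" for s s' a B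
    using edge[OF that(1,2)] by (simp add: obs[OF that(2)] bu[OF that(1,3)])
  have reach: "x = (0, {0}) \<or> (\<exists>s\<in>?Y. x = (s, ?Y))" if "(x0, x) \<in> R\<^sup>*" for x
    using that
  proof (induction rule: rtrancl_induct)
    case base
    then show ?case
      by (simp add: belief_strategy_def sync_pomdp_def)
  next
    case (step x y)
    obtain s B s' B' where xy: "x = (s, B)" "y = (s', B')"
      by (cases x; cases y)
    have B: "B \<in> {{0}, ?Y}"
      using step.IH by (auto simp: xy)
    obtain a where a: "a \<in> set_pmf (f B)" "s' \<in> sync_succ s a"
      "B' = belief_update sync_pomdp B a (obs sync_pomdp s')"
      using step.hyps(2) by (auto simp: xy edge_iff)
    have "B' = ?Y"
      using a(3) bu[OF a(1) B] obs[OF a(2)] by simp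
    then show ?case
      using succ_Y[OF a(2)] by (simp add: xy)
  qed
  obtain a where a: "a \<in> set_pmf (f ?Y)"
    using set_pmf_not_empty[of "f ?Y"] by blast
  have e: "((s, ?Y), (s', ?Y)) \<in> R" if "s' \<in> sync_succ s a" for s s'
    using R_Y[OF a that] by simp
  have bad_Y: "((s, ?Y), (3, ?Y)) \<in> R\<^sup>*" if "s \<in> ?Y" for s
  proof (cases "a = 0")
    case True
    then have "((1, ?Y), (2, ?Y)) \<in> R" "((2, ?Y), (3, ?Y)) \<in> R"
      using e[of 2 1] e[of 3 2] by (simp_all add: sync_succ_def)
    then show ?thesis
      using that by (auto intro: converse_rtrancl_into_rtrancl)
  next
    case False
    then have "((2, ?Y), (1, ?Y)) \<in> R" "((1, ?Y), (3, ?Y)) \<in> R"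
      using e[of 1 2] e[of 3 1] by (simp_all add: sync_succ_def)
    then show ?thesis
      using that by (auto intro: converse_rtrancl_into_rtrancl)
  qed
  have bad: "(x, (3, ?Y)) \<in> R\<^sup>*" if x: "(x0, x) \<in> R\<^sup>*" for x
  proof (cases "x = (0, {0})")
    case True
    obtain b where b: "b \<in> set_pmf (f {0})"
      using set_pmf_not_empty[of "f {0}"] by blast
    have "((0, {0}), (3, ?Y)) \<in> R"
      by (rule R_Y[OF b]) (simp_all add: sync_succ_def)
    then show ?thesis
      by (simp add: True r_into_rtrancl)
  next
    case False
    then show ?thesis
      using reach[OF x] bad_Y by blast
  qed
  assume "positive_winning sync_pomdp ?\<sigma> (parity_objective sync_pomdp sync_prio)"
  then obtain x l where x: "(x0, x) \<in> R\<^sup>*" and l: "settled R (sync_prio \<circ> fst) l x" "even l"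
    unfolding positive_winning_iff by blast
  \<comment> \<open>Priority 1 of the error state forces the even \<open>l\<close> down to 0, a
    priority that no state has.\<close>
  have "l \<le> (sync_prio \<circ> fst) (3, ?Y)"
    using l(1) bad[OF x] unfolding settled_def by blast
  then have "l = 0"
    using l(2) by (cases "l = 1") (auto simp: sync_prio_def)
  moreover obtain z :: "nat \<times> nat set" where "(sync_prio \<circ> fst) z = l"
    using l(1) unfolding settled_def by blast
  ultimately show False
    by (simp add: sync_prio_def split: if_splits)
qed

subsection \<open>POMDPs requiring exponential memory\<close>

text \<open>
  In \<open>Show i b k\<close> the index \<open>i\<close> is secret, \<open>k\<close> is the index just observed, and \<open>b\<close> records
  whether \<open>i\<close> has been observed so far. At any time the secret index may be revealed (\<open>Ask i b\<close>)
  and \<open>b\<close> has to be answered by the next action, so the strategy must know the set of all observed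
  indices. After a correct answer the game restarts, so that a strategy that may fail in one round
  almost surely fails.
\<close>

datatype quiz_state = Start | Lose | Show nat bool nat | Ask nat bool

instance quiz_state :: countable
  by countable_datatype

fun quiz_succ :: "nat \<Rightarrow> quiz_state \<Rightarrow> nat \<Rightarrow> quiz_state set" where
  "quiz_succ n Start a = (\<lambda>(i, k). Show i (i = k) k) ` ({..n} \<times> {..n})"
| "quiz_succ n (Show i b k) a = insert (Ask i b) ((\<lambda>k. Show i (b \<or> i = k) k) ` {..n})"
| "quiz_succ n (Ask i b) a = (if (a = 1) = b then {Start} else {Lose})"
| "quiz_succ n Lose a = {Lose}"

text \<open>Even codes from 2 on hide the secret index, odd codes from 3 on reveal it, and
  \<open>b\<close> is never observed. \<open>Start\<close> has a code of its own, as the standing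
  assumption demands.\<close>

fun quiz_obs :: "quiz_state \<Rightarrow> nat" where
  "quiz_obs Start = 0"
| "quiz_obs Lose = 1"
| "quiz_obs (Show i b k) = 2 * k + 2"
| "quiz_obs (Ask i b) = 2 * i + 3"

definition quiz_states :: "nat \<Rightarrow> quiz_state set" where
  "quiz_states n = {Start, Lose} \<union> (\<lambda>(i, b, k). Show i b k) ` ({..n} \<times> UNIV \<times> {..n}) \<union>
     (\<lambda>(i, b). Ask i b) ` ({..n} \<times> UNIV)"

definition quiz :: "nat \<Rightarrow> (nat, nat, nat) pomdp" where
  "quiz n =
     \<lparr> states = to_nat ` quiz_states n,
       actions = {0, 1},
       trans = (\<lambda>s a. pmf_of_set (to_nat ` quiz_succ n (from_nat s) a)),
       observations = {..2 * n + 3},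
       obs = (\<lambda>s. quiz_obs (from_nat s)),
       init_state = to_nat Start \<rparr>"

text \<open>As \<open>Lose\<close> is absorbing, this is the safety objective of never
  losing.\<close>

definition quiz_prio :: "nat \<Rightarrow> nat" where
  "quiz_prio s = (if from_nat s = Lose then 1 else 0)"

lemma quiz_simps:
  "states (quiz n) = to_nat ` quiz_states n" "actions (quiz n) = {0, 1}"
  "observations (quiz n) = {..2 * n + 3}" "obs (quiz n) (to_nat t) = quiz_obs t"
  "init_state (quiz n) = to_nat Start"
  by (simp_all add: quiz_def)

lemma quiz_prio_to_nat [simp]: "quiz_prio (to_nat t) = (if t = Lose then 1 else 0)"
  by (simp add: quiz_prio_def)

lemma quiz_succ_finite: "finite (quiz_succ n t a)"
  by (cases t) auto

lemma quiz_succ_nonempty: "quiz_succ n t a \<noteq> {}"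
  by (cases t) auto

lemma quiz_states_iff [simp]:
  "Start \<in> quiz_states n" "Lose \<in> quiz_states n"
  "Show i b k \<in> quiz_states n \<longleftrightarrow> i \<le> n \<and> k \<le> n" "Ask i b \<in> quiz_states n \<longleftrightarrow> i \<le> n"
  by (force simp: quiz_states_def)+

lemma quiz_succ_states: "t \<in> quiz_states n \<Longrightarrow> quiz_succ n t a \<subseteq> quiz_states n"
  by (cases t) auto

lemma finite_quiz_states: "finite (quiz_states n)"
  by (simp add: quiz_states_def)

lemma set_pmf_trans_quiz: "set_pmf (trans (quiz n) (to_nat t) a) = to_nat ` quiz_succ n t a"
  by (simp add: quiz_def quiz_succ_finite quiz_succ_nonempty)

lemma pmf_trans_quiz:
  "pmf (trans (quiz n) (to_nat t) a) s =
    indicator (to_nat ` quiz_succ n t a) s / real (card (quiz_succ n t a))"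
  by (simp add: quiz_def quiz_succ_finite quiz_succ_nonempty pmf_of_set card_image)

lemma wf_quiz: "wf_pomdp (quiz n)"
  unfolding wf_pomdp_def quiz_simps
proof (intro conjI ballI)
  show "finite (to_nat ` quiz_states n)"
    by (simp add: finite_quiz_states)
  show "to_nat Start \<in> to_nat ` quiz_states n"
    by (simp add: quiz_states_def)
  show "set_pmf (trans (quiz n) s a) \<subseteq> to_nat ` quiz_states n" if "s \<in> to_nat ` quiz_states n" for s a
    using that quiz_succ_states by (fastforce simp: set_pmf_trans_quiz)
  show "obs (quiz n) s \<in> {..2 * n + 3}" if "s \<in> to_nat ` quiz_states n" for s
    using that by (auto simp: quiz_simps quiz_states_def)
  show "{s \<in> to_nat ` quiz_states n. obs (quiz n) s = quiz_obs Start} = {to_nat Start}"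
    by (auto simp: quiz_simps quiz_states_def)
qed auto

lemma rational_quiz: "rational_pomdp (quiz n)"
  unfolding rational_pomdp_def quiz_simps
  by (auto simp: pmf_trans_quiz indicator_def)

section \<open>Polynomial size of the family\<close>

lemma card_quiz_states: "card (quiz_states n) \<le> 2 + 2 * (n + 1) ^ 2 + 2 * (n + 1)"
proof -
  have "card (quiz_states n) \<le> card {Start, Lose} +
      card ((\<lambda>(i, b, k). Show i b k) ` ({..n} \<times> (UNIV :: bool set) \<times> {..n})) +
      card ((\<lambda>(i, b). Ask i b) ` ({..n} \<times> (UNIV :: bool set)))"
    unfolding quiz_states_def by (intro order_trans[OF card_Un_le] add_mono card_Un_le order_refl)
  also have "\<dots> \<le> 2 + card ({..n} \<times> (UNIV :: bool set) \<times> {..n}) + card ({..n} \<times> (UNIV :: bool set))"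
    by (intro add_mono card_image_le) simp_all
  also have "\<dots> = 2 + 2 * (n + 1) ^ 2 + 2 * (n + 1)"
    by (simp add: card_cartesian_product power2_eq_square)
  finally show ?thesis .
qed

text \<open>Linear instead of logarithmic, from the crude \<open>c < 2 ^ c\<close>; good enough for
  a polynomial bound.\<close>

lemma bit_size_inverse_le:
  assumes "c > 0"
  shows "bit_size (1 / real c) \<le> c"
  unfolding bit_size_def
proof (rule Least_le, intro exI conjI)
  show "(1 :: nat) < 2 ^ c"
    using assms by (intro one_less_power) auto
  show "c < 2 ^ c"
    by (rule less_exp)
qed (use assms in auto)

lemma pomdp_size_quiz:
  assumes "n \<ge> 1"
  shows "pomdp_size (quiz n) \<le> 5510 * n ^ 6"
proof -
  define c where "c = card (quiz_states n)"
  have le_c: "card (quiz_succ n t a) \<le> c" if "t \<in> quiz_states n" for t a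
    unfolding c_def using quiz_succ_states[OF that] finite_quiz_states by (rule card_mono[rotated])
  have bits: "(\<Sum>s'\<in>set_pmf (trans (quiz n) s a). bit_size (pmf (trans (quiz n) s a) s')) \<le> c * c"
    if "s \<in> states (quiz n)" for s a
  proof -
    obtain t where t: "t \<in> quiz_states n" "s = to_nat t"
      using \<open>s \<in> states (quiz n)\<close> by (auto simp: quiz_simps)
    have pos: "card (quiz_succ n t a) > 0"
      by (simp add: card_gt_0_iff quiz_succ_finite quiz_succ_nonempty)
    have "(\<Sum>s'\<in>set_pmf (trans (quiz n) s a). bit_size (pmf (trans (quiz n) s a) s')) =
        (\<Sum>s'\<in>to_nat ` quiz_succ n t a. bit_size (1 / real (card (quiz_succ n t a))))"
      unfolding t(2) set_pmf_trans_quiz by (intro sum.cong) (simp_all add: pmf_trans_quiz)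
    also have "\<dots> = card (quiz_succ n t a) * bit_size (1 / real (card (quiz_succ n t a)))"
      by (simp add: card_image)
    also have "\<dots> \<le> c * c"
      using le_c[OF t(1)] bit_size_inverse_le[OF pos] by (intro mult_mono) (auto intro: order_trans)
    finally show ?thesis .
  qed
  have "(\<Sum>s\<in>states (quiz n). \<Sum>a\<in>actions (quiz n). \<Sum>s'\<in>set_pmf (trans (quiz n) s a).
      bit_size (pmf (trans (quiz n) s a) s')) \<le> (\<Sum>s\<in>states (quiz n). \<Sum>a\<in>actions (quiz n). c * c)"
    by (intro sum_mono bits)
  also have "\<dots> = 2 * c ^ 3"
    by (simp add: quiz_simps card_image c_def power3_eq_cube)
  finally have "pomdp_size (quiz n) \<le> c + 2 + (2 * n + 4) + 2 * c ^ 3"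
    by (simp add: pomdp_size_def quiz_simps card_image c_def)
  \<comment> \<open>The number of states is at most \<open>2 * n ^ 2 + 6 * n + 6\<close>, hence at
    most \<open>14 * n ^ 2\<close>; and \<open>14 + 2 + 6 + 2 * 14 ^ 3 = 5510\<close>.\<close>
  also have "\<dots> \<le> 14 * n ^ 6 + 2 * n ^ 6 + 6 * n ^ 6 + 2 * (14 * n ^ 2) ^ 3"
  proof -
    have n: "n \<le> n ^ 2" "1 \<le> n ^ 2" "n ^ 2 \<le> n ^ 6" "1 \<le> n ^ 6" "n \<le> n ^ 6"
      using assms by (auto intro: power_increasing self_le_power)
    have "c \<le> 2 * n ^ 2 + 6 * n + 6"
      using card_quiz_states[of n] by (simp add: c_def power2_eq_square algebra_simps)
    then have c: "c \<le> 14 * n ^ 2"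
      using n(1,2) by linarith
    then have "c \<le> 14 * n ^ 6" "c ^ 3 \<le> (14 * n ^ 2) ^ 3"
      using n(3) by (auto intro: power_mono order_trans)
    then show ?thesis
      using n(4,5) by linarith
  qed
  also have "\<dots> = 5510 * n ^ 6"
    by (simp add: power_mult_distrib power_mult[symmetric])
  finally show ?thesis
    by simp
qed

section \<open>Winning the quiz, and what a winner has to remember\<close>

lemma quiz_rel_iff:
  "((to_nat t, m), (s', m')) \<in> chain_rel (quiz n) \<sigma> \<longleftrightarrow>
    (\<exists>a\<in>set_pmf (select \<sigma> m). \<exists>t'\<in>quiz_succ n t a. s' = to_nat t' \<and> m' \<in> set_pmf (update \<sigma> m (quiz_obs t') a))"
  unfolding chain_rel_iff set_pmf_trans_quiz by (auto simp: quiz_simps)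

text \<open>A memory state holds the indices seen in this round and the next action.
  \<open>ob div 2 - 1\<close> decodes the index from both \<open>2 * k + 2\<close> and
  \<open>2 * i + 3\<close>; the set is dropped as soon as the answer is known.\<close>

definition recall :: "nat \<Rightarrow> (nat set \<times> nat, nat, nat) strategy" where
  "recall n =
     \<lparr> memory = Pow {..n} \<times> {0, 1},
       init_mem = ({}, 0),
       select = (\<lambda>(W, a). return_pmf a),
       update = (\<lambda>(W, a) ob _. return_pmf
         (if ob < 2 then ({}, 0)
          else if even ob then (insert (ob div 2 - 1) W, 0)
          else ({}, of_bool (ob div 2 - 1 \<in> W)))) \<rparr>"

fun recall_inv :: "quiz_state \<Rightarrow> nat set \<times> nat \<Rightarrow> bool" where
  "recall_inv Start m \<longleftrightarrow> m = ({}, 0)"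
| "recall_inv Lose m \<longleftrightarrow> False"
| "recall_inv (Show i b k) m \<longleftrightarrow> b = (i \<in> fst m)"
| "recall_inv (Ask i b) m \<longleftrightarrow> m = ({}, of_bool b)"

lemma fm_recall: "fm_strategy (quiz n) (recall n)"
  unfolding fm_strategy_def quiz_simps by (auto simp: recall_def of_bool_def split: if_splits)

lemma recall_inv_step:
  assumes "recall_inv t m" "t' \<in> quiz_succ n t (snd m)"
  shows "recall_inv t' (case m of (W, a) \<Rightarrow>
    if quiz_obs t' < 2 then ({}, 0)
    else if even (quiz_obs t') then (insert (quiz_obs t' div 2 - 1) W, 0)
    else ({}, of_bool (quiz_obs t' div 2 - 1 \<in> W)))"
  using assms by (cases t; cases m) (auto split: if_splits)

lemma almost_sure_recall: "almost_sure_winning (quiz n) (recall n) (parity_objective (quiz n) quiz_prio)"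
proof -
  interpret pomdp_strategy "quiz n" "recall n"
    by unfold_locales (rule wf_quiz, rule fm_recall)
  have inv: "\<exists>t m. x = (to_nat t, m) \<and> recall_inv t m" if "(x0, x) \<in> R\<^sup>*" for x
    using that
  proof (induction rule: rtrancl_induct)
    case base
    then show ?case
      by (auto simp: quiz_simps recall_def intro!: exI[of _ Start])
  next
    case (step x y)
    obtain t m where x: "x = (to_nat t, m)" "recall_inv t m"
      using step.IH by blast
    obtain W a where m: "m = (W, a)"
      by (cases m)
    obtain t' m' where t': "t' \<in> quiz_succ n t a" and m': "m' \<in> set_pmf (update (recall n) m (quiz_obs t') a)"
      and y: "y = (to_nat t', m')"
      using step.hyps(2) by (cases y) (auto simp: x(1) quiz_rel_iff m recall_def)
    have "recall_inv t' m'"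
      using recall_inv_step[OF x(2), of t' n] t' m' by (simp add: m recall_def)
    then show ?case
      using y by blast
  qed
  have zero: "(quiz_prio \<circ> fst) x = 0" if "(x0, x) \<in> R\<^sup>*" for x
    using inv[OF that] by auto
  have "settled R (quiz_prio \<circ> fst) 0 x" if "(x0, x) \<in> R\<^sup>*" for x
    unfolding settled_def using zero rtrancl_trans[OF that] by blast
  then show ?thesis
    unfolding almost_sure_winning_iff by (metis even_zero rtrancl.rtrancl_refl)
qed

text \<open>Positive winning constrains only the region reachable from one settled pair
  \<open>x\<close>. The restart at \<open>Start\<close> brings a fresh round into that region, where
  a fooling argument applies: two sets of shown indices that lead to the same memory state are
  separated by asking for an index in their difference.\<close>

lemma quiz_memory_lower_bound:
  assumes fm: "fm_strategy (quiz n) \<sigma>"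
    and win: "positive_winning (quiz n) \<sigma> (parity_objective (quiz n) quiz_prio)"
  shows "2 ^ n \<le> card (memory \<sigma>)"
proof -
  interpret pomdp_strategy "quiz n" \<sigma>
    by unfold_locales (rule wf_quiz, rule fm)
  obtain x l where x: "(x0, x) \<in> R\<^sup>*" and l: "settled R (quiz_prio \<circ> fst) l x" "even l"
    using win unfolding positive_winning_iff by blast
  \<comment> \<open>\<open>Lose\<close> is absorbing with priority 1, so a pair settled there would
    have odd \<open>l\<close>.\<close>
  have safe: "(x, (to_nat Lose, m)) \<notin> R\<^sup>*" for m
  proof
    assume "(x, (to_nat Lose, m)) \<in> R\<^sup>*"
    with l(1) have st: "settled R (quiz_prio \<circ> fst) l (to_nat Lose, m)"
      by (rule settled_rtrancl)
    have "fst y = to_nat Lose" if "((to_nat Lose, m), y) \<in> R\<^sup>*" for y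
      using that
    proof (induction rule: rtrancl_induct)
      case (step y z)
      then show ?case
        by (cases y; cases z) (simp add: quiz_rel_iff)
    qed simp
    moreover obtain z where "((to_nat Lose, m), z) \<in> R\<^sup>*" "(quiz_prio \<circ> fst) z = l"
      using st unfolding settled_def by blast
    ultimately show False
      using l(2) by auto
  qed
  \<comment> \<open>Indistinguishability: the memory sees only action and observation, so one
    \<open>m'\<close> fits all transitions that produce \<open>ob\<close> under
    \<open>a\<close>.\<close>
  have next_mem: "\<exists>m'. \<forall>t t'. quiz_obs t' = ob \<longrightarrow> t' \<in> quiz_succ n t a \<longrightarrow> ((to_nat t, m), (to_nat t', m')) \<in> R"
    if "a \<in> set_pmf (select \<sigma> m)" for a m ob
  proof -
    obtain m' where "m' \<in> set_pmf (update \<sigma> m ob a)"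
      using set_pmf_not_empty by fast
    then show ?thesis
      using that by (auto simp: quiz_rel_iff intro!: exI[of _ m'])
  qed
  have select: "\<exists>a. a \<in> set_pmf (select \<sigma> m)" for m
    using set_pmf_not_empty[of "select \<sigma> m"] by blast
  have ask: "\<exists>m'. (x, (to_nat Start, m')) \<in> R\<^sup>*" if "(x, (to_nat (Ask i b), m)) \<in> R\<^sup>*" for i b m
  proof -
    obtain a where a: "a \<in> set_pmf (select \<sigma> m)"
      using select by blast
    show ?thesis
    proof (cases "(a = 1) = b")
      case True
      then have "Start \<in> quiz_succ n (Ask i b) a"
        by simp
      then obtain m' where "((to_nat (Ask i b), m), (to_nat Start, m')) \<in> R"
        using next_mem[OF a, of "quiz_obs Start"] by blast
      with that show ?thesis
        by (blast intro: rtrancl_into_rtrancl)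
    next
      case False
      then have "Lose \<in> quiz_succ n (Ask i b) a"
        by simp
      then obtain m' where "((to_nat (Ask i b), m), (to_nat Lose, m')) \<in> R"
        using next_mem[OF a, of "quiz_obs Lose"] by blast
      from rtrancl_into_rtrancl[OF that this] safe show ?thesis
        by blast
    qed
  qed
  have "\<exists>m. (x, (to_nat Start, m)) \<in> R\<^sup>*"
  proof -
    have "x \<in> V"
      using R_rtrancl_V[OF x x0_V] .
    then obtain t m where t: "t \<in> quiz_states n" "x = (to_nat t, m)"
      by (auto simp: V_def quiz_simps)
    show ?thesis
    proof (cases t)
      case Start
      then show ?thesis
        using t by blast
    next
      case Lose
      then show ?thesis
        using safe[of m] t by simp
    next
      case (Ask i b)
      then show ?thesis
        using ask[of i b m] t by simp
    next
      case (Show i b k)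
      obtain a where a: "a \<in> set_pmf (select \<sigma> m)"
        using select by blast
      have "Ask i b \<in> quiz_succ n (Show i b k) a"
        by simp
      then obtain m' where "(x, (to_nat (Ask i b), m')) \<in> R"
        using next_mem[OF a, of "quiz_obs (Ask i b)"] t(2) Show by blast
      then show ?thesis
        using ask by blast
    qed
  qed
  then obtain m0 where m0: "(x, (to_nat Start, m0)) \<in> R\<^sup>*"
    by blast
  \<comment> \<open>The indices are shown independently of the secret, so a single memory state is
    compatible with every secret \<open>i\<close> at once.\<close>
  have shown: "\<exists>m. \<forall>i\<le>n. \<exists>k. (x, (to_nat (Show i (i \<in> W) k), m)) \<in> R\<^sup>*"
    if "finite W" "W \<noteq> {}" "W \<subseteq> {..n}" for W
    using that
  proof (induction rule: finite_ne_induct)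
    case (singleton k)
    obtain a where "a \<in> set_pmf (select \<sigma> m0)"
      using select by blast
    from next_mem[OF this, of "2 * k + 2"] obtain m
      where m: "\<And>t t'. quiz_obs t' = 2 * k + 2 \<Longrightarrow> t' \<in> quiz_succ n t a \<Longrightarrow> ((to_nat t, m0), (to_nat t', m)) \<in> R"
      by blast
    have "(x, (to_nat (Show i (i \<in> {k}) k), m)) \<in> R\<^sup>*" if "i \<le> n" for i
      using singleton that by (intro rtrancl_into_rtrancl[OF m0] m) auto
    then show ?case
      by blast
  next
    case (insert k W)
    then obtain m1 where m1: "\<And>i. i \<le> n \<Longrightarrow> \<exists>k. (x, (to_nat (Show i (i \<in> W) k), m1)) \<in> R\<^sup>*"
      by auto
    obtain a where "a \<in> set_pmf (select \<sigma> m1)"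
      using select by blast
    from next_mem[OF this, of "2 * k + 2"] obtain m
      where m: "\<And>t t'. quiz_obs t' = 2 * k + 2 \<Longrightarrow> t' \<in> quiz_succ n t a \<Longrightarrow> ((to_nat t, m1), (to_nat t', m)) \<in> R"
      by blast
    have "(x, (to_nat (Show i (i \<in> insert k W) k), m)) \<in> R\<^sup>*" if i: "i \<le> n" for i
    proof -
      obtain j where j: "(x, (to_nat (Show i (i \<in> W) j), m1)) \<in> R\<^sup>*"
        using m1[OF i] by blast
      show ?thesis
        using insert.prems by (intro rtrancl_into_rtrancl[OF j] m) auto
    qed
    then show ?case
      by blast
  qed
  \<comment> \<open>A round shows at least one index. Always including \<open>n\<close> makes the
    shown set non-empty and leaves the \<open>2 ^ n\<close> subsets of \<open>{..<n}\<close> to be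
    told apart.\<close>
  define mem where "mem U = (SOME m. \<forall>i\<le>n. \<exists>k. (x, (to_nat (Show i (i \<in> insert n U) k), m)) \<in> R\<^sup>*)" for U
  have mem: "\<exists>k. (x, (to_nat (Show i (i \<in> insert n U) k), mem U)) \<in> R\<^sup>*" if "U \<subseteq> {..<n}" "i \<le> n" for U i
  proof -
    have "\<exists>m. \<forall>i\<le>n. \<exists>k. (x, (to_nat (Show i (i \<in> insert n U) k), m)) \<in> R\<^sup>*"
      using that by (intro shown) (auto intro: finite_subset)
    from someI_ex[OF this] show ?thesis
      using that(2) unfolding mem_def by blast
  qed
  have differ: False if U: "U \<subseteq> {..<n}" "U' \<subseteq> {..<n}" "i \<in> U" "i \<notin> U'" and eq: "mem U = mem U'" for U U' i
  proof -
    have i: "i < n"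
      using U by auto
    obtain k where k: "(x, (to_nat (Show i True k), mem U)) \<in> R\<^sup>*"
      using mem[OF U(1), of i] i U(3) by auto
    obtain k' where k': "(x, (to_nat (Show i False k'), mem U)) \<in> R\<^sup>*"
      using mem[OF U(2), of i] i U(4) eq by auto
    obtain a where "a \<in> set_pmf (select \<sigma> (mem U))"
      using select by blast
    from next_mem[OF this, of "2 * i + 3"] obtain m where m: "\<And>t t'. quiz_obs t' = 2 * i + 3 \<Longrightarrow>
        t' \<in> quiz_succ n t a \<Longrightarrow> ((to_nat t, mem U), (to_nat t', m)) \<in> R"
      by blast
    \<comment> \<open>With equal memory both values of \<open>b\<close> are possible, and any answer
      is wrong for one of them.\<close>
    have ask': "(x, (to_nat (Ask i True), m)) \<in> R\<^sup>*" "(x, (to_nat (Ask i False), m)) \<in> R\<^sup>*"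
      by (rule rtrancl_into_rtrancl[OF k] rtrancl_into_rtrancl[OF k'], rule m; simp)+
    obtain a' where "a' \<in> set_pmf (select \<sigma> m)"
      using select by blast
    from next_mem[OF this, of 1] obtain m' where m': "\<And>t t'. quiz_obs t' = 1 \<Longrightarrow>
        t' \<in> quiz_succ n t a' \<Longrightarrow> ((to_nat t, m), (to_nat t', m')) \<in> R"
      by blast
    have "(x, (to_nat Lose, m')) \<in> R\<^sup>*"
    proof (cases "a' = 1")
      case True
      then show ?thesis
        by (intro rtrancl_into_rtrancl[OF ask'(2)] m') simp_all
    next
      case False
      then show ?thesis
        by (intro rtrancl_into_rtrancl[OF ask'(1)] m') simp_all
    qed
    with safe show False
      by blast
  qed
  have "inj_on mem (Pow {..<n})"
  proof (rule inj_onI)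
    fix U U' assume U: "U \<in> Pow {..<n}" "U' \<in> Pow {..<n}" "mem U = mem U'"
    show "U = U'"
    proof (intro equalityI subsetI)
      show "i \<in> U'" if "i \<in> U" for i
        using differ[of U U' i] U that by auto
      show "i \<in> U" if "i \<in> U'" for i
        using differ[of U' U i] U that by auto
    qed
  qed
  moreover have "mem ` Pow {..<n} \<subseteq> memory \<sigma>"
  proof clarify
    fix U assume "U \<subseteq> {..<n}"
    then obtain k where "(x, (to_nat (Show n True k), mem U)) \<in> R\<^sup>*"
      using mem[of U n] by auto
    from R_rtrancl_V[OF rtrancl_trans[OF x this] x0_V] show "mem U \<in> memory \<sigma>"
      by (simp add: V_def)
  qed
  ultimately have "card (Pow {..<n}) \<le> card (memory \<sigma>)"
    using fmD by (intro card_inj_on_le)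
  then show ?thesis
    by (simp add: card_Pow)
qed

subsection \<open>The theorem\<close>

theorem theorem3:
  shows
    "(\<forall>(G :: ('s, 'a, 'o) pomdp) (p :: 's \<Rightarrow> nat) (D :: nat set).
        wf_pomdp G \<and> finite D \<and> p ` states G \<subseteq> D \<longrightarrow>
        ((\<exists>\<sigma> :: (nat, 'a, 'o) strategy.
            fm_strategy G \<sigma> \<and> positive_winning G \<sigma> (parity_objective G p)) \<longrightarrow>
         (\<exists>\<sigma> :: (nat, 'a, 'o) strategy.
            fm_strategy G \<sigma> \<and> positive_winning G \<sigma> (parity_objective G p) \<and>
            card (memory \<sigma>) \<le> 2 ^ (3 * card D * card (states G)))) \<and>
        ((\<exists>\<sigma> :: (nat, 'a, 'o) strategy.
            fm_strategy G \<sigma> \<and> almost_sure_winning G \<sigma> (parity_objective G p)) \<longrightarrow>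
         (\<exists>\<sigma> :: (nat, 'a, 'o) strategy.
            fm_strategy G \<sigma> \<and> almost_sure_winning G \<sigma> (parity_objective G p) \<and>
            card (memory \<sigma>) \<le> 2 ^ (3 * card D * card (states G)))))
     \<and>
     (\<exists>(G :: nat \<Rightarrow> (nat, nat, nat) pomdp) (p :: nat \<Rightarrow> nat \<Rightarrow> nat).
        (\<forall>n\<ge>1. wf_pomdp (G n) \<and> rational_pomdp (G n)) \<and>
        (\<exists>C k :: nat. \<forall>n\<ge>1. pomdp_size (G n) \<le> C * n ^ k) \<and>
        (\<forall>n\<ge>1. \<exists>\<sigma> :: (nat, nat, nat) strategy.
            fm_strategy (G n) \<sigma> \<and> almost_sure_winning (G n) \<sigma> (parity_objective (G n) (p n))) \<and>
        (\<exists>(c :: real) N. c > 0 \<and>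
          (\<forall>n\<ge>1. n \<ge> N \<longrightarrow> (\<forall>\<sigma> :: (nat, nat, nat) strategy.
             fm_strategy (G n) \<sigma> \<and> almost_sure_winning (G n) \<sigma> (parity_objective (G n) (p n)) \<longrightarrow>
             real (card (memory \<sigma>)) \<ge> 2 powr (c * real n)))))
     \<and>
     (\<exists>(G :: nat \<Rightarrow> (nat, nat, nat) pomdp) (p :: nat \<Rightarrow> nat \<Rightarrow> nat).
        (\<forall>n\<ge>1. wf_pomdp (G n) \<and> rational_pomdp (G n)) \<and>
        (\<exists>C k :: nat. \<forall>n\<ge>1. pomdp_size (G n) \<le> C * n ^ k) \<and>
        (\<forall>n\<ge>1. \<exists>\<sigma> :: (nat, nat, nat) strategy.
            fm_strategy (G n) \<sigma> \<and> positive_winning (G n) \<sigma> (parity_objective (G n) (p n))) \<and>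
        (\<exists>(c :: real) N. c > 0 \<and>
          (\<forall>n\<ge>1. n \<ge> N \<longrightarrow> (\<forall>\<sigma> :: (nat, nat, nat) strategy.
             fm_strategy (G n) \<sigma> \<and> positive_winning (G n) \<sigma> (parity_objective (G n) (p n)) \<longrightarrow>
             real (card (memory \<sigma>)) \<ge> 2 powr (c * real n)))))
     \<and>
     (\<exists>(G :: (nat, nat, nat) pomdp) (p :: nat \<Rightarrow> nat).
        wf_pomdp G \<and>
        (\<exists>\<sigma> :: (nat, nat, nat) strategy.
            fm_strategy G \<sigma> \<and> almost_sure_winning G \<sigma> (parity_objective G p)) \<and>
        \<not> (\<exists>f. fm_strategy G (belief_strategy G f) \<and>
             almost_sure_winning G (belief_strategy G f) (parity_objective G p)))
     \<and>
     (\<exists>(G :: (nat, nat, nat) pomdp) (p :: nat \<Rightarrow> nat).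
        wf_pomdp G \<and>
        (\<exists>\<sigma> :: (nat, nat, nat) strategy.
            fm_strategy G \<sigma> \<and> positive_winning G \<sigma> (parity_objective G p)) \<and>
        \<not> (\<exists>f. fm_strategy G (belief_strategy G f) \<and>
             positive_winning G (belief_strategy G f) (parity_objective G p)))"
proof (intro conjI)
  show "\<forall>(G :: ('s, 'a, 'o) pomdp) (p :: 's \<Rightarrow> nat) (D :: nat set).
        wf_pomdp G \<and> finite D \<and> p ` states G \<subseteq> D \<longrightarrow>
        ((\<exists>\<sigma> :: (nat, 'a, 'o) strategy.
            fm_strategy G \<sigma> \<and> positive_winning G \<sigma> (parity_objective G p)) \<longrightarrow>
         (\<exists>\<sigma> :: (nat, 'a, 'o) strategy.
            fm_strategy G \<sigma> \<and> positive_winning G \<sigma> (parity_objective G p) \<and>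
            card (memory \<sigma>) \<le> 2 ^ (3 * card D * card (states G)))) \<and>
        ((\<exists>\<sigma> :: (nat, 'a, 'o) strategy.
            fm_strategy G \<sigma> \<and> almost_sure_winning G \<sigma> (parity_objective G p)) \<longrightarrow>
         (\<exists>\<sigma> :: (nat, 'a, 'o) strategy.
            fm_strategy G \<sigma> \<and> almost_sure_winning G \<sigma> (parity_objective G p) \<and>
            card (memory \<sigma>) \<le> 2 ^ (3 * card D * card (states G))))"
    (is "\<forall>G p D. ?assms G p D \<longrightarrow> ?pos G p D \<and> ?as G p D")
  proof (intro allI impI)
    fix G :: "('s, 'a, 'o) pomdp" and p :: "'s \<Rightarrow> nat" and D :: "nat set"
    assume asm: "?assms G p D"
    note small = pomdp_strategy.small_memory[OF pomdp_strategy.intro, of G _ D p]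
    show "?pos G p D \<and> ?as G p D"
      using asm small by blast
  qed
next
  have poly: "pomdp_size (quiz n) \<le> 5510 * n ^ 6" if "n \<ge> 1" for n
    using that by (rule pomdp_size_quiz)
  have lower: "2 powr (1 * real n) \<le> real (card (memory \<sigma>))"
    if "fm_strategy (quiz n) \<sigma>" "positive_winning (quiz n) \<sigma> (parity_objective (quiz n) quiz_prio)"
    for n and \<sigma> :: "(nat, nat, nat) strategy"
    using of_nat_mono[OF quiz_memory_lower_bound[OF that], where 'a = real] by (simp add: powr_realpow)
  \<comment> \<open>The memory of \<open>recall\<close> consists of pairs;
    \<open>small_memory\<close> turns it into a strategy with memory in \<open>nat\<close>.\<close>
  have ex: "\<exists>\<sigma> :: (nat, nat, nat) strategy. fm_strategy (quiz n) \<sigma> \<and>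
      almost_sure_winning (quiz n) \<sigma> (parity_objective (quiz n) quiz_prio)" for n
    using pomdp_strategy.small_memory[where p = quiz_prio,
        OF pomdp_strategy.intro[OF wf_quiz fm_recall[of n]] _ order_refl]
      almost_sure_recall finite_quiz_states by (auto simp: quiz_simps)
  show "\<exists>(G :: nat \<Rightarrow> (nat, nat, nat) pomdp) (p :: nat \<Rightarrow> nat \<Rightarrow> nat).
        (\<forall>n\<ge>1. wf_pomdp (G n) \<and> rational_pomdp (G n)) \<and>
        (\<exists>C k :: nat. \<forall>n\<ge>1. pomdp_size (G n) \<le> C * n ^ k) \<and>
        (\<forall>n\<ge>1. \<exists>\<sigma> :: (nat, nat, nat) strategy.
            fm_strategy (G n) \<sigma> \<and> almost_sure_winning (G n) \<sigma> (parity_objective (G n) (p n))) \<and>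
        (\<exists>(c :: real) N. c > 0 \<and>
          (\<forall>n\<ge>1. n \<ge> N \<longrightarrow> (\<forall>\<sigma> :: (nat, nat, nat) strategy.
             fm_strategy (G n) \<sigma> \<and> almost_sure_winning (G n) \<sigma> (parity_objective (G n) (p n)) \<longrightarrow>
             real (card (memory \<sigma>)) \<ge> 2 powr (c * real n))))"
  proof (rule exI[of _ quiz], rule exI[of _ "\<lambda>_. quiz_prio"], intro conjI allI impI)
    show "wf_pomdp (quiz n)" "rational_pomdp (quiz n)" for n
      by (rule wf_quiz rational_quiz)+
    show "\<exists>C k. \<forall>n\<ge>1. pomdp_size (quiz n) \<le> C * n ^ k"
      by (intro exI allI impI) (rule poly)
    show "\<exists>\<sigma> :: (nat, nat, nat) strategy. fm_strategy (quiz n) \<sigma> \<and>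
        almost_sure_winning (quiz n) \<sigma> (parity_objective (quiz n) quiz_prio)" for n
      by (rule ex)
    show "\<exists>(c :: real) N. c > 0 \<and> (\<forall>n\<ge>1. n \<ge> N \<longrightarrow> (\<forall>\<sigma> :: (nat, nat, nat) strategy.
        fm_strategy (quiz n) \<sigma> \<and> almost_sure_winning (quiz n) \<sigma> (parity_objective (quiz n) quiz_prio) \<longrightarrow>
        real (card (memory \<sigma>)) \<ge> 2 powr (c * real n)))"
      by (rule exI[of _ 1], rule exI[of _ 0], intro conjI allI impI, simp, rule lower)
        (auto intro: almost_sure_imp_positive_winning)
  qed
  show "\<exists>(G :: nat \<Rightarrow> (nat, nat, nat) pomdp) (p :: nat \<Rightarrow> nat \<Rightarrow> nat).
        (\<forall>n\<ge>1. wf_pomdp (G n) \<and> rational_pomdp (G n)) \<and>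
        (\<exists>C k :: nat. \<forall>n\<ge>1. pomdp_size (G n) \<le> C * n ^ k) \<and>
        (\<forall>n\<ge>1. \<exists>\<sigma> :: (nat, nat, nat) strategy.
            fm_strategy (G n) \<sigma> \<and> positive_winning (G n) \<sigma> (parity_objective (G n) (p n))) \<and>
        (\<exists>(c :: real) N. c > 0 \<and>
          (\<forall>n\<ge>1. n \<ge> N \<longrightarrow> (\<forall>\<sigma> :: (nat, nat, nat) strategy.
             fm_strategy (G n) \<sigma> \<and> positive_winning (G n) \<sigma> (parity_objective (G n) (p n)) \<longrightarrow>
             real (card (memory \<sigma>)) \<ge> 2 powr (c * real n))))"
  proof (rule exI[of _ quiz], rule exI[of _ "\<lambda>_. quiz_prio"], intro conjI allI impI)
    show "wf_pomdp (quiz n)" "rational_pomdp (quiz n)" for n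
      by (rule wf_quiz rational_quiz)+
    show "\<exists>C k. \<forall>n\<ge>1. pomdp_size (quiz n) \<le> C * n ^ k"
      by (intro exI allI impI) (rule poly)
    show "\<exists>\<sigma> :: (nat, nat, nat) strategy. fm_strategy (quiz n) \<sigma> \<and>
        positive_winning (quiz n) \<sigma> (parity_objective (quiz n) quiz_prio)" for n
      using ex[of n] almost_sure_imp_positive_winning by blast
    show "\<exists>(c :: real) N. c > 0 \<and> (\<forall>n\<ge>1. n \<ge> N \<longrightarrow> (\<forall>\<sigma> :: (nat, nat, nat) strategy.
        fm_strategy (quiz n) \<sigma> \<and> positive_winning (quiz n) \<sigma> (parity_objective (quiz n) quiz_prio) \<longrightarrow>
        real (card (memory \<sigma>)) \<ge> 2 powr (c * real n)))"
      by (rule exI[of _ 1], rule exI[of _ 0], intro conjI allI impI, simp, rule lower)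
        (auto)
  qed
next
  show "\<exists>(G :: (nat, nat, nat) pomdp) (p :: nat \<Rightarrow> nat).
        wf_pomdp G \<and>
        (\<exists>\<sigma> :: (nat, nat, nat) strategy.
            fm_strategy G \<sigma> \<and> almost_sure_winning G \<sigma> (parity_objective G p)) \<and>
        \<not> (\<exists>f. fm_strategy G (belief_strategy G f) \<and>
             almost_sure_winning G (belief_strategy G f) (parity_objective G p))"
    using wf_sync almost_sure_alternate no_belief_strategy_sync almost_sure_imp_positive_winning by blast
  show "\<exists>(G :: (nat, nat, nat) pomdp) (p :: nat \<Rightarrow> nat).
        wf_pomdp G \<and>
        (\<exists>\<sigma> :: (nat, nat, nat) strategy.
            fm_strategy G \<sigma> \<and> positive_winning G \<sigma> (parity_objective G p)) \<and>
        \<not> (\<exists>f. fm_strategy G (belief_strategy G f) \<and>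
             positive_winning G (belief_strategy G f) (parity_objective G p))"
    using wf_sync almost_sure_alternate no_belief_strategy_sync almost_sure_imp_positive_winning by blast
qed

end
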